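(* Let $n\geqslant 3$. The monomorphism $\eta: A_{B_n}\to A_{A_n}$ defined by $\eta(\tau_1)=\sigma_1^2$ and $\eta(\tau_i)=\sigma_i$ for $2\leqslant i\leqslant n$ is a quasi-isometry between $(A_{B_n},d_{\mathcal{P}(A_{B_n})})$ and $(A_{A_n},d_{\mathcal{P}(A_{A_n})})$.
   Context: Artin-Tits groups. $A_{A_n}$ is the braid group on $n+1$ strands, with standard generators $\sigma_1,\dots,\sigma_n$ and relations $\sigma_i\sigma_j=\sigma_j\sigma_i$ for $|i-j|\geqslant 2$ and $\sigma_i\sigma_{i+1}\sigma_i=\sigma_{i+1}\sigma_i\sigma_{i+1}$ for $1\leqslant i\leqslant n-1$. $A_{B_n}$ is the Artin-Tits group of type $B_n$, with standard generators $\tau_1,\dots,\tau_n$ and relations $\tau_i\tau_j=\tau_j\tau_i$ for $|i-j|\geqslant 2$, $\tau_1\tau_2\tau_1\tau_2=\tau_2\tau_1\tau_2\tau_1$, and $\tau_i\tau_{i+1}\tau_i=\tau_{i+1}\tau_i\tau_{i+1}$ for $2\leqslant i\leqslant n-1$. It is well known that $\eta$ is an injective homomorphism. Garside elements: $\Delta_{A_n}=(\sigma_1\cdots\sigma_n)(\sigma_1\cdots\sigma_{n-1})\cdots(\sigma_1\sigma_2)\sigma_1$ and $\Delta_{B_n}=(\tau_1\tau_2\cdots\tau_n)^n$. Let $A$ be $A_{A_n}$ or $A_{B_n}$. A proper irreducible standard parabolic subgroup of $A$ is a subgroup generated by the standard generators with index in $I$, where $I$ is a nonempty proper subset of $\{1,\dots,n\}$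 consisting of consecutive integers. $\mathcal{P}(A)$ is the union of all proper irreducible standard parabolic subgroups of $A$ together with the cyclic subgroup generated by the square of the Garside element of $A$; it is an (infinite) generating set of $A$. $d_{\mathcal{P}(A)}$ is the associated word metric: $d_{\mathcal{P}(A)}(g,h)$ is the minimal length of a word in elements of $\mathcal{P}(A)$ representing $g^{-1}h$. *)

theory Defs
  imports Complex_Main "HOL-Algebra.Generated_Groups"
begin

section \<open>Groups given by generators and relations\<close>

text \<open>A word over \<open>S\<close> is a list of letters \<open>(x, b)\<close> with \<open>x \<in> S\<close>; the letter \<open>(x, True)\<close>
  stands for \<open>x\<close> and \<open>(x, False)\<close> for its inverse.\<close>

type_synonym 'a gword = "('a \<times> bool) list"

definition words :: "'a set \<Rightarrow> 'a gword set" where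
  "words S = lists (S \<times> UNIV)"

inductive pres_eq :: "'a set \<Rightarrow> ('a gword \<times> 'a gword) set \<Rightarrow> 'a gword \<Rightarrow> 'a gword \<Rightarrow> bool"
  for S R where
  rel: "(u, v) \<in> R \<Longrightarrow> pres_eq S R u v"
| cancel: "x \<in> S \<Longrightarrow> pres_eq S R [(x, b), (x, \<not> b)] []"
| refl: "w \<in> words S \<Longrightarrow> pres_eq S R w w"
| sym: "pres_eq S R u v \<Longrightarrow> pres_eq S R v u"
| trans: "pres_eq S R u v \<Longrightarrow> pres_eq S R v w \<Longrightarrow> pres_eq S R u w"
| mult: "pres_eq S R u u' \<Longrightarrow> pres_eq S R v v' \<Longrightarrow> pres_eq S R (u @ v) (u' @ v')"

definition pres_class :: "'a set \<Rightarrow> ('a gword \<times> 'a gword) set \<Rightarrow> 'a gword \<Rightarrow> 'a gword set" where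
  "pres_class S R u = {v. pres_eq S R u v}"

definition presented_group :: "'a set \<Rightarrow> ('a gword \<times> 'a gword) set \<Rightarrow> 'a gword set monoid" where
  "presented_group S R =
     \<lparr>carrier = pres_class S R ` words S,
      mult = (\<lambda>X Y. \<Union>u\<in>X. \<Union>v\<in>Y. pres_class S R (u @ v)),
      one = pres_class S R []\<rparr>"

definition pres_gen :: "'a set \<Rightarrow> ('a gword \<times> 'a gword) set \<Rightarrow> 'a \<Rightarrow> 'a gword set" where
  "pres_gen S R x = pres_class S R [(x, True)]"

definition list_prod :: "('g, 'm) monoid_scheme \<Rightarrow> 'g list \<Rightarrow> 'g" where
  "list_prod G gs = foldr (mult G) gs \<one>\<^bsub>G\<^esub>"

definition eval_word :: "('g, 'm) monoid_scheme \<Rightarrow> ('a \<Rightarrow> 'g) \<Rightarrow> 'a gword \<Rightarrow> 'g" where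
  "eval_word G f w = list_prod G (map (\<lambda>(x, b). if b then f x else inv\<^bsub>G\<^esub> (f x)) w)"

text \<open>The map out of a presented group induced by an assignment \<open>f\<close> on generators; it sends the
  class of a word to the common value of its members, which exists as soon as \<open>f\<close> respects the
  relations (lemma \<open>pres_lift_class\<close>).\<close>

definition pres_lift :: "('g, 'm) monoid_scheme \<Rightarrow> ('a \<Rightarrow> 'g) \<Rightarrow> 'a gword set \<Rightarrow> 'g" where
  "pres_lift G f X = the_elem (eval_word G f ` X)"

section \<open>Artin-Tits groups of types A and B\<close>

definition pos_word :: "'a list \<Rightarrow> 'a gword" where
  "pos_word xs = map (\<lambda>x. (x, True)) xs"

definition commutation_rels :: "nat \<Rightarrow> (nat gword \<times> nat gword) set" where
  "commutation_rels n =
     {(pos_word [i, j], pos_word [j, i]) | i j.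
        i \<in> {1..n} \<and> j \<in> {1..n} \<and> \<bar>int i - int j\<bar> \<ge> 2}"

definition rels_A :: "nat \<Rightarrow> (nat gword \<times> nat gword) set" where
  "rels_A n = commutation_rels n \<union>
     {(pos_word [i, i+1, i], pos_word [i+1, i, i+1]) | i. 1 \<le> i \<and> i + 1 \<le> n}"

definition rels_B :: "nat \<Rightarrow> (nat gword \<times> nat gword) set" where
  "rels_B n = commutation_rels n \<union>
     (if n \<ge> 2 then {(pos_word [1, 2, 1, 2], pos_word [2, 1, 2, 1])} else {}) \<union>
     {(pos_word [i, i+1, i], pos_word [i+1, i, i+1]) | i. 2 \<le> i \<and> i + 1 \<le> n}"

definition artin_A :: "nat \<Rightarrow> nat gword set monoid" where
  "artin_A n = presented_group {1..n} (rels_A n)"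

definition artin_B :: "nat \<Rightarrow> nat gword set monoid" where
  "artin_B n = presented_group {1..n} (rels_B n)"

definition sigma :: "nat \<Rightarrow> nat \<Rightarrow> nat gword set" where
  "sigma n = pres_gen {1..n} (rels_A n)"

definition tau :: "nat \<Rightarrow> nat \<Rightarrow> nat gword set" where
  "tau n = pres_gen {1..n} (rels_B n)"

text \<open>The product runs over the blocks \<open>\<sigma>\<^sub>1 \<dots> \<sigma>\<^sub>k\<close> for \<open>k = n, n - 1, \<dots>, 1\<close>.\<close>

definition Delta_A :: "nat \<Rightarrow> nat gword set" where
  "Delta_A n = list_prod (artin_A n)
     (map (\<lambda>k. list_prod (artin_A n) (map (sigma n) [1..<k+1])) (rev [1..<n+1]))"

definition Delta_B :: "nat \<Rightarrow> nat gword set" where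
  "Delta_B n = list_prod (artin_B n) (map (tau n) [1..<n+1]) [^]\<^bsub>artin_B n\<^esub> n"

text \<open>Nonempty sets of consecutive integers are the intervals \<open>{a..b}\<close> with \<open>a \<le> b\<close>.\<close>

definition parabolics ::
    "('g, 'm) monoid_scheme \<Rightarrow> nat \<Rightarrow> (nat \<Rightarrow> 'g) \<Rightarrow> 'g set set" where
  "parabolics G n s =
     {generate G (s ` {a..b}) | a b. a \<le> b \<and> {a..b} \<subset> {1..n}}"

definition P_A :: "nat \<Rightarrow> nat gword set set" where
  "P_A n = \<Union>(parabolics (artin_A n) n (sigma n)) \<union>
     generate (artin_A n) {Delta_A n [^]\<^bsub>artin_A n\<^esub> (2::nat)}"

definition P_B :: "nat \<Rightarrow> nat gword set set" where
  "P_B n = \<Union>(parabolics (artin_B n) n (tau n)) \<union>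
     generate (artin_B n) {Delta_B n [^]\<^bsub>artin_B n\<^esub> (2::nat)}"

definition eta :: "nat \<Rightarrow> nat gword set \<Rightarrow> nat gword set" where
  "eta n = pres_lift (artin_A n)
     (\<lambda>i. if i = 1 then sigma n 1 [^]\<^bsub>artin_A n\<^esub> (2::nat) else sigma n i)"

section \<open>Word metrics and quasi-isometries\<close>

text \<open>Words in the elements of \<open>P\<close> themselves, without inverses: the sets \<open>P_A\<close> and \<open>P_B\<close> are
  unions of subgroups.\<close>

definition word_dist :: "('g, 'm) monoid_scheme \<Rightarrow> 'g set \<Rightarrow> 'g \<Rightarrow> 'g \<Rightarrow> nat" where
  "word_dist G P g h =
     (LEAST k. \<exists>ps. length ps = k \<and> set ps \<subseteq> P \<and> list_prod G ps = inv\<^bsub>G\<^esub> g \<otimes>\<^bsub>G\<^esub> h)"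

definition quasi_isometry ::
    "'a set \<Rightarrow> ('a \<Rightarrow> 'a \<Rightarrow> real) \<Rightarrow> 'b set \<Rightarrow> ('b \<Rightarrow> 'b \<Rightarrow> real) \<Rightarrow> ('a \<Rightarrow> 'b) \<Rightarrow> bool" where
  "quasi_isometry X dX Y dY f \<longleftrightarrow>
     f ` X \<subseteq> Y \<and>
     (\<exists>K C. K \<ge> 1 \<and> C \<ge> 0 \<and>
        (\<forall>x\<in>X. \<forall>x'\<in>X. dX x x' / K - C \<le> dY (f x) (f x') \<and> dY (f x) (f x') \<le> K * dX x x' + C)) \<and>
     (\<exists>D. \<forall>y\<in>Y. \<exists>x\<in>X. dY (f x) y \<le> D)"

section \<open>Well-definedness\<close>

lemma pres_eq_words:
  assumes "R \<subseteq> words S \<times> words S" "pres_eq S R u v"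
  shows "u \<in> words S \<and> v \<in> words S"
  using assms(2) by induction (use assms(1) in \<open>auto simp: words_def\<close>)

lemma pres_class_eq_iff:
  assumes "v \<in> words S"
  shows "pres_class S R u = pres_class S R v \<longleftrightarrow> pres_eq S R u v"
  using assms by (auto simp: pres_class_def intro: pres_eq.intros)

lemma presented_mult:
  assumes "u \<in> words S" "v \<in> words S"
  shows "pres_class S R u \<otimes>\<^bsub>presented_group S R\<^esub> pres_class S R v = pres_class S R (u @ v)"
proof -
  have "pres_eq S R u u" "pres_eq S R v v"
    using assms by (auto intro: pres_eq.refl)
  then show ?thesis
    unfolding presented_group_def pres_class_def
    by (auto intro: pres_eq.trans pres_eq.mult)
qed

lemma presented_carrier: "carrier (presented_group S R) = pres_class S R ` words S"
  and presented_one: "\<one>\<^bsub>presented_group S R\<^esub> = pres_class S R []"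
  by (simp_all add: presented_group_def)

definition inv_word :: "'a gword \<Rightarrow> 'a gword" where
  "inv_word w = rev (map (\<lambda>(x, b). (x, \<not> b)) w)"

lemma inv_word_words: "w \<in> words S \<Longrightarrow> inv_word w \<in> words S"
  by (auto simp: words_def inv_word_def)

lemma inv_word_left:
  assumes "w \<in> words S"
  shows "pres_eq S R (inv_word w @ w) []"
  using assms
proof (induction w)
  case Nil
  then show ?case by (auto simp: inv_word_def words_def intro: pres_eq.refl)
next
  case (Cons l w)
  obtain x b where l: "l = (x, b)" by (cases l)
  have x: "x \<in> S" and w: "w \<in> words S" using Cons.prems by (auto simp: l words_def)
  have c: "pres_eq S R [(x, \<not> b), (x, b)] []"
    using pres_eq.cancel[OF x, of R "\<not> b"] by simp
  have "pres_eq S R (inv_word w @ [(x, \<not> b), (x, b)] @ w) (inv_word w @ [] @ w)"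
    using inv_word_words[OF w] w c by (intro pres_eq.mult pres_eq.refl) auto
  with Cons.IH[OF w] have "pres_eq S R (inv_word w @ [(x, \<not> b), (x, b)] @ w) []"
    by (auto intro: pres_eq.trans)
  then show ?case by (simp add: inv_word_def l)
qed

lemma group_presented: "group (presented_group S R)"
proof (rule groupI)
  fix X Y Z
  assume "X \<in> carrier (presented_group S R)" "Y \<in> carrier (presented_group S R)"
    "Z \<in> carrier (presented_group S R)"
  then obtain u v w where "X = pres_class S R u" "Y = pres_class S R v" "Z = pres_class S R w"
    "u \<in> words S" "v \<in> words S" "w \<in> words S"
    by (auto simp: presented_carrier)
  moreover have "u @ v \<in> words S" "v @ w \<in> words S"
    using calculation by (auto simp: words_def)
  ultimately show "X \<otimes>\<^bsub>presented_group S R\<^esub> Y \<otimes>\<^bsub>presented_group S R\<^esub> Z =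
      X \<otimes>\<^bsub>presented_group S R\<^esub> (Y \<otimes>\<^bsub>presented_group S R\<^esub> Z)"
    by (simp add: presented_mult)
next
  fix X assume "X \<in> carrier (presented_group S R)"
  then obtain u where u: "X = pres_class S R u" "u \<in> words S"
    by (auto simp: presented_carrier)
  have "[] \<in> words S" by (simp add: words_def)
  then show "\<one>\<^bsub>presented_group S R\<^esub> \<otimes>\<^bsub>presented_group S R\<^esub> X = X"
    using u by (simp add: presented_one presented_mult)
  have "pres_class S R (inv_word u) \<otimes>\<^bsub>presented_group S R\<^esub> X = \<one>\<^bsub>presented_group S R\<^esub>"
    using u inv_word_left[OF u(2), of R] inv_word_words[OF u(2)] \<open>[] \<in> words S\<close>
    by (simp add: presented_mult presented_one pres_class_eq_iff)
  then show "\<exists>Y\<in>carrier (presented_group S R).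
      Y \<otimes>\<^bsub>presented_group S R\<^esub> X = \<one>\<^bsub>presented_group S R\<^esub>"
    using inv_word_words[OF u(2)] by (auto simp: presented_carrier)
next
  fix X Y assume "X \<in> carrier (presented_group S R)" "Y \<in> carrier (presented_group S R)"
  then obtain u v where "X = pres_class S R u" "Y = pres_class S R v"
    "u \<in> words S" "v \<in> words S"
    by (auto simp: presented_carrier)
  moreover have "u @ v \<in> words S" using calculation by (simp add: words_def)
  ultimately show "X \<otimes>\<^bsub>presented_group S R\<^esub> Y \<in> carrier (presented_group S R)"
    by (simp add: presented_mult presented_carrier)
qed (auto simp: presented_carrier presented_one words_def)

lemma pres_gen_in: "x \<in> S \<Longrightarrow> pres_gen S R x \<in> carrier (presented_group S R)"
  by (auto simp: pres_gen_def presented_carrier words_def)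

context group
begin

lemma list_prod_closed: "set gs \<subseteq> carrier G \<Longrightarrow> list_prod G gs \<in> carrier G"
  by (induction gs) (auto simp: list_prod_def)

lemma list_prod_append:
  "set gs \<subseteq> carrier G \<Longrightarrow> set hs \<subseteq> carrier G \<Longrightarrow>
    list_prod G (gs @ hs) = list_prod G gs \<otimes> list_prod G hs"
proof (induction gs)
  case Nil
  then show ?case using list_prod_closed[of hs] by (simp add: list_prod_def)
next
  case (Cons g gs)
  then show ?case
    using list_prod_closed[of gs] list_prod_closed[of hs] by (simp add: list_prod_def m_assoc)
qed

lemma eval_word_letters:
  assumes "f ` S \<subseteq> carrier G" "w \<in> words S"
  shows "set (map (\<lambda>(x, b). if b then f x else inv (f x)) w) \<subseteq> carrier G"
  using assms by (force simp: words_def image_subset_iff)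

lemma eval_word_closed: "f ` S \<subseteq> carrier G \<Longrightarrow> w \<in> words S \<Longrightarrow> eval_word G f w \<in> carrier G"
  unfolding eval_word_def by (intro list_prod_closed eval_word_letters)

lemma eval_word_append:
  assumes "f ` S \<subseteq> carrier G" "u \<in> words S" "v \<in> words S"
  shows "eval_word G f (u @ v) = eval_word G f u \<otimes> eval_word G f v"
  using list_prod_append[OF eval_word_letters[OF assms(1,2)] eval_word_letters[OF assms(1,3)]]
  by (simp add: eval_word_def)

lemma eval_word_pres_eq:
  assumes "f ` S \<subseteq> carrier G" "R \<subseteq> words S \<times> words S"
    and "\<And>u v. (u, v) \<in> R \<Longrightarrow> eval_word G f u = eval_word G f v"
    and "pres_eq S R u v"
  shows "eval_word G f u = eval_word G f v"
  using assms(4)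
proof induction
  case (cancel x b)
  then show ?case using assms(1) by (auto simp: eval_word_def list_prod_def image_subset_iff)
next
  case (mult u u' v v')
  then show ?case
    using eval_word_append[OF assms(1)] pres_eq_words[OF assms(2)] by metis
qed (use assms(3) in auto)

lemma pres_lift_class:
  assumes "f ` S \<subseteq> carrier G" "R \<subseteq> words S \<times> words S"
    and "\<And>u v. (u, v) \<in> R \<Longrightarrow> eval_word G f u = eval_word G f v"
    and "w \<in> words S"
  shows "pres_lift G f (pres_class S R w) = eval_word G f w"
proof -
  have "eval_word G f ` pres_class S R w = {eval_word G f w}"
    using eval_word_pres_eq[OF assms(1-3)] pres_eq.refl[OF assms(4)]
    by (fastforce simp: pres_class_def)
  then show ?thesis by (simp add: pres_lift_def)
qed

lemma pres_lift_hom: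
  assumes "f ` S \<subseteq> carrier G" "R \<subseteq> words S \<times> words S"
    and "\<And>u v. (u, v) \<in> R \<Longrightarrow> eval_word G f u = eval_word G f v"
  shows "pres_lift G f \<in> hom (presented_group S R) G"
proof (rule homI)
  fix X assume "X \<in> carrier (presented_group S R)"
  then show "pres_lift G f X \<in> carrier G"
    using pres_lift_class[OF assms] eval_word_closed[OF assms(1)] by (auto simp: presented_carrier)
next
  fix X Y assume "X \<in> carrier (presented_group S R)" "Y \<in> carrier (presented_group S R)"
  then obtain u v where uv: "X = pres_class S R u" "Y = pres_class S R v"
    "u \<in> words S" "v \<in> words S"
    by (auto simp: presented_carrier)
  moreover have "u @ v \<in> words S" using uv by (auto simp: words_def)
  ultimately show "pres_lift G f (X \<otimes>\<^bsub>presented_group S R\<^esub> Y) = pres_lift G f X \<otimes> pres_lift G f Y"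
    using pres_lift_class[OF assms] eval_word_append[OF assms(1)] by (simp add: presented_mult)
qed

lemma pres_lift_gen:
  assumes "f ` S \<subseteq> carrier G" "R \<subseteq> words S \<times> words S"
    and "\<And>u v. (u, v) \<in> R \<Longrightarrow> eval_word G f u = eval_word G f v"
    and "x \<in> S"
  shows "pres_lift G f (pres_gen S R x) = f x"
proof -
  have "[(x, True)] \<in> words S" using assms(4) by (simp add: words_def)
  then have "pres_lift G f (pres_gen S R x) = eval_word G f [(x, True)]"
    unfolding pres_gen_def by (intro pres_lift_class[OF assms(1-3)])
  then show ?thesis using assms(1,4) by (auto simp: eval_word_def list_prod_def)
qed

end

lemma rels_A_words: "rels_A n \<subseteq> words {1..n} \<times> words {1..n}"
  by (auto simp: rels_A_def commutation_rels_def pos_word_def words_def)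

lemma rels_B_words: "rels_B n \<subseteq> words {1..n} \<times> words {1..n}"
  by (auto simp: rels_B_def commutation_rels_def pos_word_def words_def)

lemma group_artin_A: "group (artin_A n)" and group_artin_B: "group (artin_B n)"
  by (simp_all add: artin_A_def artin_B_def group_presented)

lemma sigma_in: "i \<in> {1..n} \<Longrightarrow> sigma n i \<in> carrier (artin_A n)"
  and tau_in: "i \<in> {1..n} \<Longrightarrow> tau n i \<in> carrier (artin_B n)"
  by (simp_all add: sigma_def tau_def artin_A_def artin_B_def pres_gen_in)

lemma sigma_commute:
  assumes "i \<in> {1..n}" "j \<in> {1..n}" "\<bar>int i - int j\<bar> \<ge> 2"
  shows "sigma n i \<otimes>\<^bsub>artin_A n\<^esub> sigma n j = sigma n j \<otimes>\<^bsub>artin_A n\<^esub> sigma n i"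
proof -
  have "(pos_word [i, j], pos_word [j, i]) \<in> rels_A n"
    using assms by (auto simp: rels_A_def commutation_rels_def)
  then have "pres_class {1..n} (rels_A n) (pos_word [i, j]) =
      pres_class {1..n} (rels_A n) (pos_word [j, i])"
    using rels_A_words[of n] by (subst pres_class_eq_iff) (auto intro: pres_eq.rel)
  then show ?thesis
    using assms by (simp add: sigma_def pres_gen_def artin_A_def pos_word_def presented_mult words_def)
qed

lemma sigma_braid:
  assumes "1 \<le> i" "i + 1 \<le> n"
  shows "sigma n i \<otimes>\<^bsub>artin_A n\<^esub> (sigma n (i+1) \<otimes>\<^bsub>artin_A n\<^esub> sigma n i) =
    sigma n (i+1) \<otimes>\<^bsub>artin_A n\<^esub> (sigma n i \<otimes>\<^bsub>artin_A n\<^esub> sigma n (i+1))"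
proof -
  have "(pos_word [i, i+1, i], pos_word [i+1, i, i+1]) \<in> rels_A n"
    using assms by (auto simp: rels_A_def)
  then have "pres_class {1..n} (rels_A n) (pos_word [i, i+1, i]) =
      pres_class {1..n} (rels_A n) (pos_word [i+1, i, i+1])"
    using rels_A_words[of n] by (subst pres_class_eq_iff) (auto intro: pres_eq.rel)
  then show ?thesis
    using assms by (simp add: sigma_def pres_gen_def artin_A_def pos_word_def presented_mult words_def)
qed

lemma eta_respects:
  assumes "(u, v) \<in> rels_B n"
  defines "f \<equiv> (\<lambda>i. if i = 1 then sigma n 1 [^]\<^bsub>artin_A n\<^esub> (2::nat) else sigma n i)"
  shows "eval_word (artin_A n) f u = eval_word (artin_A n) f v"
proof -
  interpret group "artin_A n" by (rule group_artin_A)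
  have ev: "eval_word (artin_A n) f (pos_word xs) = list_prod (artin_A n) (map f xs)" for xs
    by (simp add: eval_word_def pos_word_def comp_def)
  have f1: "f (Suc 0) = sigma n 1 \<otimes>\<^bsub>artin_A n\<^esub> sigma n 1" if "1 \<le> n"
    using that sigma_in[of 1 n] by (simp add: f_def numeral_2_eq_2)
  have fi: "f i = sigma n i" if "i \<noteq> 1" for i
    using that by (simp add: f_def)
  have fc: "f i \<in> carrier (artin_A n)" if "i \<in> {1..n}" for i
    using that sigma_in[of i n] sigma_in[of 1 n] by (simp add: f_def)
  have sq: "(a \<otimes>\<^bsub>artin_A n\<^esub> a) \<otimes>\<^bsub>artin_A n\<^esub> b = b \<otimes>\<^bsub>artin_A n\<^esub> (a \<otimes>\<^bsub>artin_A n\<^esub> a)"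
    if "a \<otimes>\<^bsub>artin_A n\<^esub> b = b \<otimes>\<^bsub>artin_A n\<^esub> a" "a \<in> carrier (artin_A n)" "b \<in> carrier (artin_A n)"
    for a b
    using that by (metis m_assoc)
  consider
    (comm) i j where "i \<in> {1..n}" "j \<in> {1..n}" "\<bar>int i - int j\<bar> \<ge> 2"
      "u = pos_word [i, j]" "v = pos_word [j, i]"
  | (four) "2 \<le> n" "u = pos_word [1, 2, 1, 2]" "v = pos_word [2, 1, 2, 1]"
  | (braid) i where "2 \<le> i" "i + 1 \<le> n" "u = pos_word [i, i+1, i]" "v = pos_word [i+1, i, i+1]"
    using assms(1) by (auto simp: rels_B_def commutation_rels_def split: if_splits)
  then show ?thesis
  proof cases
    case comm
    note c = sigma_in[OF comm(1)] sigma_in[OF comm(2)]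
    have "f i \<otimes>\<^bsub>artin_A n\<^esub> f j = f j \<otimes>\<^bsub>artin_A n\<^esub> f i"
    proof -
      consider "i = 1" "j \<noteq> 1" | "j = 1" "i \<noteq> 1" | "i \<noteq> 1" "j \<noteq> 1"
        using comm(3) by linarith
      then show ?thesis
      proof cases
        case 1
        then show ?thesis using f1 fi[of j] sq[OF sigma_commute[OF comm(1-3)] c] comm(1) by simp
      next
        case 2
        have "sigma n j \<otimes>\<^bsub>artin_A n\<^esub> sigma n i = sigma n i \<otimes>\<^bsub>artin_A n\<^esub> sigma n j"
          using sigma_commute[OF comm(1-3)] by simp
        with 2 show ?thesis using f1 fi[of i] sq[of "sigma n j" "sigma n i"] c comm(2) by simp
      next
        case 3
        then show ?thesis using fi sigma_commute[OF comm(1-3)] by simp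
      qed
    qed
    then show ?thesis using comm fc by (simp add: ev list_prod_def)
  next
    case four
    define a b where "a = sigma n 1" and "b = sigma n 2"
    have c: "a \<in> carrier (artin_A n)" "b \<in> carrier (artin_A n)"
      using four(1) sigma_in[of 1 n] sigma_in[of 2 n] by (auto simp: a_def b_def)
    have ff: "f (Suc 0) = a \<otimes>\<^bsub>artin_A n\<^esub> a" "f 2 = b"
      using f1 fi[of 2] four(1) by (auto simp: a_def b_def)
    have br: "a \<otimes>\<^bsub>artin_A n\<^esub> (b \<otimes>\<^bsub>artin_A n\<^esub> a) = b \<otimes>\<^bsub>artin_A n\<^esub> (a \<otimes>\<^bsub>artin_A n\<^esub> b)"
      using sigma_braid[of 1 n] four(1) by (simp add: a_def b_def numeral_2_eq_2)
    have br': "a \<otimes>\<^bsub>artin_A n\<^esub> (b \<otimes>\<^bsub>artin_A n\<^esub> (a \<otimes>\<^bsub>artin_A n\<^esub> x)) =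
        b \<otimes>\<^bsub>artin_A n\<^esub> (a \<otimes>\<^bsub>artin_A n\<^esub> (b \<otimes>\<^bsub>artin_A n\<^esub> x))" if "x \<in> carrier (artin_A n)" for x
      using br c that by (metis m_assoc m_closed)
    have "a \<otimes>\<^bsub>artin_A n\<^esub> (a \<otimes>\<^bsub>artin_A n\<^esub> (b \<otimes>\<^bsub>artin_A n\<^esub> (a \<otimes>\<^bsub>artin_A n\<^esub> (a \<otimes>\<^bsub>artin_A n\<^esub> b)))) =
       b \<otimes>\<^bsub>artin_A n\<^esub> (a \<otimes>\<^bsub>artin_A n\<^esub> (a \<otimes>\<^bsub>artin_A n\<^esub> (b \<otimes>\<^bsub>artin_A n\<^esub> (a \<otimes>\<^bsub>artin_A n\<^esub> a))))"
      using c br br' by (metis m_closed)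
    then show ?thesis using four c by (simp add: ev list_prod_def ff m_assoc)
  next
    case braid
    then show ?thesis
      using sigma_braid[of i n] sigma_in[of i n] sigma_in[of "i+1" n]
      by (simp add: ev list_prod_def fi)
  qed
qed

lemma
  shows eta_hom: "eta n \<in> hom (artin_B n) (artin_A n)"
    and eta_tau1: "1 \<le> n \<Longrightarrow> eta n (tau n 1) = sigma n 1 [^]\<^bsub>artin_A n\<^esub> (2::nat)"
    and eta_tau: "2 \<le> i \<Longrightarrow> i \<le> n \<Longrightarrow> eta n (tau n i) = sigma n i"
proof -
  interpret group "artin_A n" by (rule group_artin_A)
  let ?f = "\<lambda>i. if i = 1 then sigma n 1 [^]\<^bsub>artin_A n\<^esub> (2::nat) else sigma n i"
  have f: "?f ` {1..n} \<subseteq> carrier (artin_A n)"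
    using sigma_in[of _ n] by auto
  note l = f rels_B_words eta_respects
  show "eta n \<in> hom (artin_B n) (artin_A n)"
    unfolding eta_def artin_B_def by (rule pres_lift_hom[OF l])
  show "eta n (tau n 1) = sigma n 1 [^]\<^bsub>artin_A n\<^esub> (2::nat)" if "1 \<le> n"
    using pres_lift_gen[OF l, of 1] that by (simp add: eta_def tau_def)
  show "eta n (tau n i) = sigma n i" if "2 \<le> i" "i \<le> n"
    using pres_lift_gen[OF l, of i] that by (simp add: eta_def tau_def)
qed

text \<open>The sets \<open>P_A\<close> and \<open>P_B\<close> generate as monoids, so the minimum in \<open>word_dist\<close> is attained.\<close>

lemma presented_list_prod:
  assumes gens: "\<And>x. x \<in> S \<Longrightarrow> pres_gen S R x \<in> P \<and> inv\<^bsub>presented_group S R\<^esub> (pres_gen S R x) \<in> P"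
    and "w \<in> words S"
  shows "\<exists>ps. set ps \<subseteq> P \<and> list_prod (presented_group S R) ps = pres_class S R w"
  using assms(2)
proof (induction w)
  case Nil
  then show ?case
    by (intro exI[of _ "[]"]) (simp add: list_prod_def presented_one)
next
  case (Cons l w)
  interpret group "presented_group S R" by (rule group_presented)
  obtain x b where l: "l = (x, b)" by (cases l)
  have x: "x \<in> S" and w: "w \<in> words S" using Cons.prems by (auto simp: l words_def)
  obtain ps where ps: "set ps \<subseteq> P" "list_prod (presented_group S R) ps = pres_class S R w"
    using Cons.IH[OF w] by blast
  have s: "[(x, c)] \<in> words S" for c using x by (simp add: words_def)
  have e: "[] \<in> words S" by (simp add: words_def)
  have "pres_class S R [(x, False)] \<otimes>\<^bsub>presented_group S R\<^esub> pres_gen S R x =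
      \<one>\<^bsub>presented_group S R\<^esub>"
    using pres_eq.cancel[OF x, of R False] s e
    by (simp add: pres_gen_def presented_mult presented_one pres_class_eq_iff)
  then have "inv\<^bsub>presented_group S R\<^esub> (pres_gen S R x) = pres_class S R [(x, False)]"
    using s pres_gen_in[OF x] by (intro inv_equality) (auto simp: presented_carrier)
  then have "pres_class S R [(x, b)] \<in> P"
    using gens[OF x] by (cases b) (auto simp: pres_gen_def)
  moreover have "list_prod (presented_group S R) (pres_class S R [(x, b)] # ps) =
      pres_class S R (l # w)"
    using ps(2) s w presented_mult[of "[(x, b)]" S w R] by (simp add: list_prod_def l)
  ultimately show ?case using ps(1)
    by (intro exI[of _ "pres_class S R [(x, b)] # ps"]) auto
qed

lemma P_A_generates:
  assumes "2 \<le> n" "g \<in> carrier (artin_A n)"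
  shows "\<exists>ps. set ps \<subseteq> P_A n \<and> list_prod (artin_A n) ps = g"
proof -
  have "generate (artin_A n) (sigma n ` {i..i}) \<subseteq> P_A n" if "i \<in> {1..n}" for i
  proof -
    have "{i..i} \<subset> {1..n}" proof -
      have "card {i..i} \<noteq> card {1..n}" using assms(1) by simp
      then have "{i..i} \<noteq> {1..n}" by metis
      then show ?thesis using that by auto
    qed
    then show ?thesis unfolding P_A_def parabolics_def by blast
  qed
  then have "sigma n i \<in> P_A n \<and> inv\<^bsub>artin_A n\<^esub> (sigma n i) \<in> P_A n" if "i \<in> {1..n}" for i
    using that by (fastforce intro: generate.incl generate.inv)
  then show ?thesis
    using presented_list_prod[of "{1..n}" "rels_A n" "P_A n"] assms(2)
    by (fastforce simp: artin_A_def sigma_def presented_carrier)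
qed

lemma P_B_generates:
  assumes "2 \<le> n" "g \<in> carrier (artin_B n)"
  shows "\<exists>ps. set ps \<subseteq> P_B n \<and> list_prod (artin_B n) ps = g"
proof -
  have "generate (artin_B n) (tau n ` {i..i}) \<subseteq> P_B n" if "i \<in> {1..n}" for i
  proof -
    have "{i..i} \<subset> {1..n}" proof -
      have "card {i..i} \<noteq> card {1..n}" using assms(1) by simp
      then have "{i..i} \<noteq> {1..n}" by metis
      then show ?thesis using that by auto
    qed
    then show ?thesis unfolding P_B_def parabolics_def by blast
  qed
  then have "tau n i \<in> P_B n \<and> inv\<^bsub>artin_B n\<^esub> (tau n i) \<in> P_B n" if "i \<in> {1..n}" for i
    using that by (fastforce intro: generate.incl generate.inv)
  then show ?thesis
    using presented_list_prod[of "{1..n}" "rels_B n" "P_B n"] assms(2)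
    by (fastforce simp: artin_B_def tau_def presented_carrier)
qed

end

theory Submission
  imports Defs
begin

text \<open>
  The image of \<open>eta\<close> consists of the braids fixing the first strand and has index \<open>n + 1\<close>, with
  coset representatives \<open>t\<^sub>k = \<sigma>\<^sub>k \<dots> \<sigma>\<^sub>1\<close>. Rewriting \<open>\<sigma>\<^sub>i t\<^sub>k = t\<^sub>l eta(h)\<close> as in the
  Reidemeister-Schreier procedure suggests a cocycle on words with values in the group of type B.
  That it respects the relations of type A is a computation in the group of type B alone, so the
  cocycle descends to the braid group; on the image of \<open>eta\<close> (and the coset of \<open>t\<^sub>0 = 1\<close>) it is a
  left inverse of \<open>eta\<close>, which gives injectivity.

  Both generating sets are matched up to bounded length. Since \<open>eta(\<Delta>\<^sub>B) = \<Delta>\<^sub>A\<^sup>2\<close>, \<open>eta\<close> maps \<open>P_B\<close>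
  into \<open>P_A\<close>. Conversely the cocycle is bounded on \<open>P_A\<close>: every proper interval lies in
  \<open>{1..n-1}\<close>, where the cocycle takes values in standard parabolic subgroups, or in \<open>{2..n}\<close>, which
  is carried to \<open>{1..n-1}\<close> by conjugation with \<open>\<sigma>\<^sub>1 \<dots> \<sigma>\<^sub>n\<close>; and on the central powers of \<open>\<Delta>\<^sub>A\<^sup>2\<close>
  it takes the value of the corresponding power of \<open>\<Delta>\<^sub>B\<close> on every coset.
\<close>

section \<open>Word balls in groups\<close>

context group
begin

text \<open>Writing conjugation as \<open>z \<otimes> a = b \<otimes> z\<close> avoids inverses.
  With \<open>intertwine_mult\<close>, such identities compose and multiply, which carries most
  computations below.\<close>

lemma intertwine_comp:
  assumes "x \<otimes> b = c \<otimes> x" "y \<otimes> a = b \<otimes> y"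
    and [simp]: "x \<in> carrier G" "y \<in> carrier G" "a \<in> carrier G" "b \<in> carrier G" "c \<in> carrier G"
  shows "(x \<otimes> y) \<otimes> a = c \<otimes> (x \<otimes> y)"
proof -
  have "(x \<otimes> y) \<otimes> a = x \<otimes> (y \<otimes> a)" by (simp add: m_assoc)
  also have "\<dots> = (x \<otimes> b) \<otimes> y" by (simp add: assms(2) m_assoc)
  finally show ?thesis by (simp add: assms(1) m_assoc)
qed

lemma intertwine_mult:
  assumes "z \<otimes> a = b \<otimes> z" "z \<otimes> x = y \<otimes> z"
    and [simp]: "z \<in> carrier G" "x \<in> carrier G" "y \<in> carrier G" "a \<in> carrier G" "b \<in> carrier G"
  shows "z \<otimes> (a \<otimes> x) = (b \<otimes> y) \<otimes> z"
proof -
  have "z \<otimes> (a \<otimes> x) = (z \<otimes> a) \<otimes> x" by (simp add: m_assoc)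
  also have "\<dots> = b \<otimes> (z \<otimes> x)" by (simp add: assms(1) m_assoc)
  finally show ?thesis by (simp add: assms(2) m_assoc)
qed

lemma commute_inv:
  assumes "x \<otimes> y = y \<otimes> x" "x \<in> carrier G" "y \<in> carrier G"
  shows "inv x \<otimes> y = y \<otimes> inv x"
  using assms by (metis inv_closed inv_solve_left' inv_solve_right' m_assoc m_closed)

lemma mult_inv_cancel: "x \<in> carrier G \<Longrightarrow> y \<in> carrier G \<Longrightarrow> x \<otimes> (inv x \<otimes> y) = y"
  and inv_mult_cancel: "x \<in> carrier G \<Longrightarrow> y \<in> carrier G \<Longrightarrow> inv x \<otimes> (x \<otimes> y) = y"
  by (simp_all add: m_assoc[symmetric])

lemma commute_generate:
  assumes "p \<in> generate G H" "H \<subseteq> carrier G" "d \<in> carrier G"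
    and "\<And>x. x \<in> H \<Longrightarrow> x \<otimes> d = d \<otimes> x"
  shows "p \<otimes> d = d \<otimes> p"
  using assms(1)
proof induction
  case (inv h)
  then show ?case using assms by (intro commute_inv) auto
next
  case (eng h1 h2)
  then show ?case using generate_in_carrier[OF assms(2)] assms(3) by (metis m_assoc)
qed (use assms in auto)

text \<open>Bounding the length instead of fixing it makes balls grow with the radius, so radii can
  be added and enlarged without finding shortest words.\<close>

definition word_ball :: "'a set \<Rightarrow> nat \<Rightarrow> 'a set" where
  "word_ball P m = {list_prod G ps | ps. set ps \<subseteq> P \<and> length ps \<le> m}"

lemma word_ball_mono: "x \<in> word_ball P l \<Longrightarrow> l \<le> m \<Longrightarrow> x \<in> word_ball P m"
  by (fastforce simp: word_ball_def)

lemma word_ball_one: "\<one> \<in> word_ball P m"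
  unfolding word_ball_def by (intro CollectI exI[of _ "[]"]) (simp add: list_prod_def)

lemma word_ball_incl: "P \<subseteq> carrier G \<Longrightarrow> x \<in> P \<Longrightarrow> x \<in> word_ball P 1"
  unfolding word_ball_def by (intro CollectI exI[of _ "[x]"]) (auto simp: list_prod_def)

lemma word_ball_mult:
  assumes "P \<subseteq> carrier G" "x \<in> word_ball P l" "y \<in> word_ball P m"
  shows "x \<otimes> y \<in> word_ball P (l + m)"
proof -
  obtain ps qs where "set ps \<subseteq> P" "length ps \<le> l" "x = list_prod G ps"
    "set qs \<subseteq> P" "length qs \<le> m" "y = list_prod G qs"
    using assms(2,3) by (auto simp: word_ball_def)
  then show ?thesis using list_prod_append[of ps qs] assms(1)
    by (auto simp: word_ball_def intro!: exI[of _ "ps @ qs"])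
qed

lemma word_ball_bounded:
  assumes "\<And>x. x \<in> carrier G \<Longrightarrow> \<exists>ps. set ps \<subseteq> P \<and> list_prod G ps = x"
    and "\<And>k. k \<le> (n::nat) \<Longrightarrow> f k \<in> carrier G"
  shows "\<exists>m. \<forall>k\<le>n. f k \<in> word_ball P m"
proof -
  have "\<exists>m. f k \<in> word_ball P m" if "k \<le> n" for k
    using assms(1)[OF assms(2)[OF that]] unfolding word_ball_def by (smt (verit) mem_Collect_eq order_refl)
  then obtain l where l: "\<And>k. k \<le> n \<Longrightarrow> f k \<in> word_ball P (l k)" by metis
  \<comment> \<open>The sum of the finitely many radii serves as a common radius.\<close>
  have "l k \<le> (\<Sum>k\<le>n. l k)" if "k \<le> n" for k
    using that by (intro member_le_sum) auto
  then show ?thesis using l word_ball_mono by blast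
qed

lemma word_dist_le: "inv g \<otimes> h \<in> word_ball P m \<Longrightarrow> word_dist G P g h \<le> m"
proof -
  assume "inv g \<otimes> h \<in> word_ball P m"
  then obtain ps where ps: "set ps \<subseteq> P" "list_prod G ps = inv g \<otimes> h" "length ps \<le> m"
    by (auto simp: word_ball_def)
  have "word_dist G P g h \<le> length ps"
    unfolding word_dist_def by (rule Least_le) (use ps in blast)
  then show ?thesis using ps(3) by simp
qed

lemma word_dist_attained:
  assumes "\<And>x. x \<in> carrier G \<Longrightarrow> \<exists>ps. set ps \<subseteq> P \<and> list_prod G ps = x"
    and "g \<in> carrier G" "h \<in> carrier G"
  obtains ps where "set ps \<subseteq> P" "length ps = word_dist G P g h" "list_prod G ps = inv g \<otimes> h"
proof -
  have "\<exists>k ps. length ps = k \<and> set ps \<subseteq> P \<and> list_prod G ps = inv g \<otimes> h"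
    using assms(1)[of "inv g \<otimes> h"] assms(2,3) by auto
  then have "\<exists>ps. length ps = word_dist G P g h \<and> set ps \<subseteq> P \<and> list_prod G ps = inv g \<otimes> h"
    unfolding word_dist_def by (rule LeastI_ex)
  then show ?thesis using that by blast
qed

end

text \<open>Allows induction over \<open>generate\<close> for elements of a presented group.\<close>

lemma presented_generate:
  "carrier (presented_group S R) = generate (presented_group S R) (pres_gen S R ` S)"
proof -
  interpret group "presented_group S R" by (rule group_presented)
  let ?H = "generate (presented_group S R) (pres_gen S R ` S)"
  have gens: "pres_gen S R ` S \<subseteq> carrier (presented_group S R)" by (auto intro: pres_gen_in)
  have "pres_class S R w \<in> ?H" if w: "w \<in> words S" for w
  proof -
    obtain ps where "set ps \<subseteq> ?H" "list_prod (presented_group S R) ps = pres_class S R w"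
      using presented_list_prod[of S R ?H w] w by (auto intro: generate.incl generate.inv)
    moreover have "list_prod (presented_group S R) ps \<in> ?H" if "set ps \<subseteq> ?H" for ps
      using that by (induction ps) (auto simp: list_prod_def intro: generate.one generate.eng)
    ultimately show ?thesis by metis
  qed
  then show ?thesis using generate_in_carrier[OF gens] by (auto simp: presented_carrier)
qed

section \<open>The full twist of the braid group\<close>

locale braid_generators = group G for G (structure) +
  fixes s :: "nat \<Rightarrow> 'a" and n :: nat
  assumes s_closed [simp]: "1 \<le> i \<Longrightarrow> i \<le> n \<Longrightarrow> s i \<in> carrier G"
    and s_comm: "1 \<le> i \<Longrightarrow> i + 2 \<le> j \<Longrightarrow> j \<le> n \<Longrightarrow> s i \<otimes> s j = s j \<otimes> s i"
    and s_braid: "1 \<le> i \<Longrightarrow> i < n \<Longrightarrow> s i \<otimes> (s (Suc i) \<otimes> s i) = s (Suc i) \<otimes> (s i \<otimes> s (Suc i))"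
begin

primrec asc :: "nat \<Rightarrow> 'a" where
  "asc 0 = \<one>"
| "asc (Suc k) = asc k \<otimes> s (Suc k)"

primrec desc :: "nat \<Rightarrow> 'a" where
  "desc 0 = \<one>"
| "desc (Suc k) = s (Suc k) \<otimes> desc k"

text \<open>The half twist on the first \<open>k + 1\<close> strands; \<open>gars n\<close> becomes
  \<open>Delta_A n\<close> in \<open>gars_list_prod\<close>.\<close>

primrec gars :: "nat \<Rightarrow> 'a" where
  "gars 0 = \<one>"
| "gars (Suc k) = asc (Suc k) \<otimes> gars k"

primrec run :: "nat \<Rightarrow> nat \<Rightarrow> 'a" where
  "run m 0 = \<one>"
| "run m (Suc j) = run m j \<otimes> s (m - j)"

lemma asc_closed [simp]: "k \<le> n \<Longrightarrow> asc k \<in> carrier G"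
  by (induction k) auto

lemma desc_closed [simp]: "k \<le> n \<Longrightarrow> desc k \<in> carrier G"
  by (induction k) auto

lemma gars_closed [simp]: "k \<le> n \<Longrightarrow> gars k \<in> carrier G"
  by (induction k) auto

lemma run_closed [simp]: "m \<le> n \<Longrightarrow> j \<le> m \<Longrightarrow> run m j \<in> carrier G"
  by (induction j) auto

lemma asc_comm: "k + 2 \<le> j \<Longrightarrow> j \<le> n \<Longrightarrow> asc k \<otimes> s j = s j \<otimes> asc k"
proof (induction k)
  case (Suc k)
  then show ?case using s_comm[of "Suc k" j] by (simp add: intertwine_comp[of "asc k" "s j"])
qed simp

lemma desc_comm: "k + 2 \<le> j \<Longrightarrow> j \<le> n \<Longrightarrow> desc k \<otimes> s j = s j \<otimes> desc k"
proof (induction k)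
  case (Suc k)
  then show ?case using s_comm[of "Suc k" j] by (simp add: intertwine_comp[of _ "s j"])
qed simp

lemma gars_comm: "k + 2 \<le> j \<Longrightarrow> j \<le> n \<Longrightarrow> gars k \<otimes> s j = s j \<otimes> gars k"
proof (induction k)
  case (Suc k)
  then show ?case using asc_comm[of "Suc k" j]
    by (simp add: intertwine_comp[of _ "s j"] del: asc.simps)
qed simp

text \<open>The new factor \<open>s (Suc k)\<close> commutes with \<open>s i\<close> unless
  \<open>i = k\<close>. In that case the braid relation brings \<open>s (Suc k)\<close> to the
  front, where it passes \<open>asc (k - 1)\<close>.\<close>

lemma asc_shift: "1 \<le> i \<Longrightarrow> i < k \<Longrightarrow> k \<le> n \<Longrightarrow> asc k \<otimes> s i = s (Suc i) \<otimes> asc k"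
proof (induction k)
  case (Suc k)
  show ?case
  proof (cases "i = k")
    case False
    then show ?thesis using Suc s_comm[of i "Suc k"]
      by (simp add: intertwine_comp[of _ "s i"])
  next
    case True
    then obtain l where l: "k = Suc l" using Suc.prems by (cases k) auto
    have "asc (Suc k) \<otimes> s i = asc l \<otimes> (s k \<otimes> (s (Suc k) \<otimes> s k))"
      using Suc.prems True l by (simp add: m_assoc)
    also have "\<dots> = (asc l \<otimes> s (Suc k)) \<otimes> (s k \<otimes> s (Suc k))"
      using Suc.prems True l s_braid[of k] by (simp add: m_assoc)
    also have "\<dots> = s (Suc i) \<otimes> asc (Suc k)"
      using Suc.prems True l asc_comm[of l "Suc k"] by (simp add: m_assoc)
    finally show ?thesis .
  qed
qed simp

lemma desc_shift: "1 \<le> i \<Longrightarrow> i < k \<Longrightarrow> k \<le> n \<Longrightarrow> desc k \<otimes> s (Suc i) = s i \<otimes> desc k"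
proof (induction k)
  case (Suc k)
  show ?case
  proof (cases "i = k")
    case False
    then show ?thesis using Suc s_comm[of i "Suc k"]
      by (simp add: intertwine_comp[of _ "s i"])
  next
    case True
    then obtain l where l: "k = Suc l" using Suc.prems by (cases k) auto
    have "desc (Suc k) \<otimes> s (Suc i) = s (Suc k) \<otimes> (s k \<otimes> (desc l \<otimes> s (Suc k)))"
      using Suc.prems True l by (simp add: m_assoc)
    also have "\<dots> = (s (Suc k) \<otimes> (s k \<otimes> s (Suc k))) \<otimes> desc l"
      using Suc.prems True l desc_comm[of l "Suc k"] by (simp add: m_assoc)
    also have "\<dots> = s i \<otimes> desc (Suc k)"
      using Suc.prems True l s_braid[of k, symmetric] by (simp add: m_assoc)
    finally show ?thesis .
  qed
qed simp

text \<open>Peels the half twist from the other end, since the new top generator commutes with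
  \<open>gars k\<close>. This form handles the top generator in \<open>gars_flip\<close> and the
  middle factor in \<open>gars_square\<close>.\<close>

lemma gars_Suc_desc: "Suc k \<le> n \<Longrightarrow> gars (Suc k) = gars k \<otimes> desc (Suc k)"
proof (induction k)
  case (Suc k)
  have "gars (Suc (Suc k)) = asc (Suc k) \<otimes> (s (Suc (Suc k)) \<otimes> gars k) \<otimes> desc (Suc k)"
    using Suc by (simp add: m_assoc del: gars.simps(2)) (simp add: m_assoc)
  also have "\<dots> = gars (Suc k) \<otimes> desc (Suc (Suc k))"
    using Suc.prems gars_comm[of k "Suc (Suc k)", symmetric] by (simp add: m_assoc)
  finally show ?case .
qed simp

text \<open>Below the top generator, \<open>gars k\<close> reflects the index and
  \<open>asc (Suc k)\<close> then shifts it by one. The top generator needs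
  \<open>gars_Suc_desc\<close>: \<open>desc (Suc k)\<close> takes it to \<open>s k\<close>, and
  \<open>gars k\<close> takes that to \<open>s 1\<close>.\<close>

lemma gars_flip: "1 \<le> i \<Longrightarrow> i \<le> k \<Longrightarrow> k \<le> n \<Longrightarrow> gars k \<otimes> s i = s (Suc k - i) \<otimes> gars k"
proof (induction k arbitrary: i)
  case (Suc k)
  show ?case
  proof (cases "i = Suc k")
    case False
    then have "asc (Suc k) \<otimes> s (Suc k - i) = s (Suc (Suc k) - i) \<otimes> asc (Suc k)"
      using asc_shift[of "Suc k - i" "Suc k"] Suc.prems by (simp add: Suc_diff_le)
    then show ?thesis
      using Suc False by (simp add: intertwine_comp[of _ "s (Suc k - i)"] del: asc.simps)
  next
    case True
    show ?thesis
    proof (cases k)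
      case 0
      then show ?thesis using Suc.prems True by simp
    next
      case (Suc l)
      have "gars k \<otimes> s k = s 1 \<otimes> gars k" using Suc.IH[of k] Suc.prems \<open>k = Suc l\<close> by simp
      moreover have "desc (Suc k) \<otimes> s i = s k \<otimes> desc (Suc k)"
        using desc_shift[of k "Suc k"] Suc.prems True \<open>k = Suc l\<close> by simp
      ultimately show ?thesis
        using Suc.prems True \<open>k = Suc l\<close> gars_Suc_desc[of k]
        by (simp add: intertwine_comp[of _ "s k"] del: asc.simps desc.simps gars.simps)
    qed
  qed
qed simp

lemma gars_square_central:
  assumes "1 \<le> i" "i \<le> n"
  shows "(gars n \<otimes> gars n) \<otimes> s i = s i \<otimes> (gars n \<otimes> gars n)"
  using assms gars_flip[of i n] gars_flip[of "Suc n - i" n]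
  by (intro intertwine_comp[of _ "s (Suc n - i)"]) auto

text \<open>In \<open>desc (Suc k) \<otimes> asc (Suc k)\<close> one strand runs once around the
  others, so it commutes with the generators acting on those: \<open>asc\<close> shifts an index up
  and \<open>desc\<close> shifts it back.\<close>

lemma desc_asc_comm_gars:
  assumes "l \<le> k" "Suc k \<le> n"
  shows "(desc (Suc k) \<otimes> asc (Suc k)) \<otimes> gars l = gars l \<otimes> (desc (Suc k) \<otimes> asc (Suc k))"
proof -
  define z where "z = desc (Suc k) \<otimes> asc (Suc k)"
  have z [simp]: "z \<in> carrier G" unfolding z_def using assms by (intro m_closed) auto
  have zs: "z \<otimes> s i = s i \<otimes> z" if "1 \<le> i" "i \<le> k" for i
    unfolding z_def using that assms asc_shift[of i "Suc k"] desc_shift[of i "Suc k"]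
    by (intro intertwine_comp[of _ "s (Suc i)"]) (auto simp del: asc.simps desc.simps)
  have za: "z \<otimes> asc j = asc j \<otimes> z" if "j \<le> k" for j
    using that
  proof (induction j)
    case (Suc j)
    then show ?case using zs[of "Suc j"] assms
      by (simp add: intertwine_comp[of _ z, symmetric])
  qed simp
  show ?thesis using assms(1) unfolding z_def[symmetric]
  proof (induction l)
    case (Suc j)
    then show ?case using za[of "Suc j"] assms
      by (simp add: intertwine_comp[of _ z, symmetric] del: asc.simps)
  qed simp
qed

lemma run_desc: "j \<le> k \<Longrightarrow> k \<le> n \<Longrightarrow> run k j \<otimes> desc (k - j) = desc k"
proof (induction j)
  case (Suc j)
  then have "k - j = Suc (k - Suc j)" by simp
  then have "desc (k - j) = s (k - j) \<otimes> desc (k - Suc j)" by simp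
  then show ?case using Suc by (simp add: m_assoc)
qed simp

lemma run_Suc_left: "j \<le> k \<Longrightarrow> Suc k \<le> n \<Longrightarrow> s (Suc k) \<otimes> run k j = run (Suc k) (Suc j)"
proof (induction j)
  case (Suc j)
  then have "s (Suc k) \<otimes> run k (Suc j) = run (Suc k) (Suc j) \<otimes> s (k - j)"
    by (simp add: m_assoc[symmetric] del: run.simps(2)) (simp add: m_assoc[symmetric])
  then show ?case by simp
qed simp

lemma run_asc: "j \<le> k \<Longrightarrow> Suc k \<le> n \<Longrightarrow> run (Suc k) j \<otimes> asc (Suc k) = asc (Suc k) \<otimes> run k j"
proof (induction j)
  case (Suc j)
  have "asc (Suc k) \<otimes> s (k - j) = s (Suc k - j) \<otimes> asc (Suc k)"
    using asc_shift[of "k - j" "Suc k"] Suc.prems by (simp add: Suc_diff_le)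
  then have "run (Suc k) (Suc j) \<otimes> asc (Suc k) = (run (Suc k) j \<otimes> asc (Suc k)) \<otimes> s (k - j)"
    using Suc.prems by (simp add: m_assoc del: asc.simps)
  then show ?case using Suc by (simp add: m_assoc del: asc.simps)
qed simp

text \<open>Collects the top generators at the right end. A further factor
  \<open>asc (Suc k)\<close> passes \<open>run\<close> while lowering its indices, and its own last
  generator extends \<open>run\<close> by one.\<close>

lemma asc_pow:
  "j \<le> Suc k \<Longrightarrow> Suc k \<le> n \<Longrightarrow> asc (Suc k) [^] j = asc k [^] j \<otimes> run (Suc k) j"
proof (induction j)
  case (Suc j)
  have "asc (Suc k) [^] Suc j = asc k [^] j \<otimes> (run (Suc k) j \<otimes> asc (Suc k))"
    using Suc by (simp add: m_assoc)
  also have "\<dots> = asc k [^] j \<otimes> (asc k \<otimes> (s (Suc k) \<otimes> run k j))"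
    using Suc.prems run_asc[of j k] by (simp add: m_assoc)
  also have "\<dots> = asc k [^] Suc j \<otimes> run (Suc k) (Suc j)"
    using Suc.prems run_Suc_left[of j k] by (simp add: m_assoc del: run.simps)
  finally show ?case .
qed simp

lemma gars_square: "k \<le> n \<Longrightarrow> gars k \<otimes> gars k = asc k [^] Suc k"
proof (induction k)
  case (Suc k)
  have "gars (Suc k) \<otimes> gars (Suc k) = gars k \<otimes> ((desc (Suc k) \<otimes> asc (Suc k)) \<otimes> gars k)"
    using Suc.prems gars_Suc_desc[of k]
    by (metis asc_closed desc_closed gars_closed gars.simps(2) m_assoc m_closed Suc_leD)
  also have "\<dots> = (gars k \<otimes> gars k) \<otimes> (desc (Suc k) \<otimes> asc (Suc k))"
    using Suc.prems desc_asc_comm_gars[of k k] by (simp add: m_assoc del: asc.simps desc.simps)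
  also have "\<dots> = asc k [^] Suc k \<otimes> desc (Suc k) \<otimes> asc (Suc k)"
    using Suc by (simp add: m_assoc del: asc.simps desc.simps nat_pow_Suc)
  \<comment> \<open>In \<open>asc_pow\<close> with \<open>j = Suc k\<close>, the collected run is
    all of \<open>desc (Suc k)\<close>.\<close>
  also have "\<dots> = asc (Suc k) [^] Suc (Suc k)"
    using Suc.prems asc_pow[of "Suc k" k] run_desc[of "Suc k" "Suc k"]
    by (simp del: asc.simps(2) desc.simps(2) run.simps nat_pow_Suc add: nat_pow_Suc[of _ "Suc k"])
  finally show ?case .
qed simp

text \<open>\<open>s 1 \<otimes> asc n\<close> is the shape of the image of \<open>tau n 1\<close>,
  ..., \<open>tau n n\<close> multiplied in order. An extra \<open>s 1\<close> becomes
  \<open>s (Suc i)\<close> when moved left across \<open>asc n [^] i\<close>, so the extra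
  generators line up as \<open>asc j\<close>.\<close>

lemma mixed_pow: "j \<le> n \<Longrightarrow> (s 1 \<otimes> asc n) [^] j = asc j \<otimes> asc n [^] j"
proof (induction j)
  case (Suc j)
  have sh: "asc n [^] i \<otimes> s 1 = s (Suc i) \<otimes> asc n [^] i" if "Suc i \<le> n" for i
    using that
  proof (induction i)
    case (Suc i)
    have "(asc n \<otimes> asc n [^] i) \<otimes> s 1 = s (Suc (Suc i)) \<otimes> (asc n \<otimes> asc n [^] i)"
      using Suc asc_shift[of "Suc i" n] by (intro intertwine_comp[of _ "s (Suc i)"]) auto
    then show ?case using nat_pow_Suc2[of "asc n" i] by simp
  qed simp
  have "(s 1 \<otimes> asc n) [^] Suc j = asc j \<otimes> ((asc n [^] j \<otimes> s 1) \<otimes> asc n)"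
    using Suc by (simp add: m_assoc)
  also have "\<dots> = asc (Suc j) \<otimes> asc n [^] Suc j"
    using Suc.prems sh[of j] by (simp add: m_assoc)
  finally show ?case .
qed simp

text \<open>For \<open>j = n\<close> the collected generators form one more factor
  \<open>asc n\<close>. This is what yields \<open>eta_Delta_B\<close>.\<close>

lemma gars_square_mixed: "gars n \<otimes> gars n = (s 1 \<otimes> asc n) [^] n"
proof -
  have "(s 1 \<otimes> asc n) [^] n = asc n [^] Suc n"
    using mixed_pow[of n] nat_pow_Suc2[of "asc n" n] by simp
  then show ?thesis using gars_square[of n] by simp
qed

end

section \<open>A cocycle with values in the group of type B\<close>

text \<open>Strands are numbered from 0, so \<open>\<sigma>\<^sub>i\<close> exchanges the strands \<open>i - 1\<close> and \<open>i\<close>.\<close>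

definition swap :: "nat \<Rightarrow> nat \<Rightarrow> nat" where
  "swap i k = (if k = i then i - 1 else if Suc k = i then i else k)"

text \<open>The last letter acts first; a letter and its inverse act alike because transpositions
  are involutions.\<close>

primrec wperm :: "nat gword \<Rightarrow> nat \<Rightarrow> nat" where
  "wperm [] k = k"
| "wperm (l # w) k = swap (fst l) (wperm w k)"

lemma swap_swap [simp]: "1 \<le> i \<Longrightarrow> swap i (swap i k) = k"
  by (auto simp: swap_def)

lemma swap_le: "i \<le> n \<Longrightarrow> k \<le> n \<Longrightarrow> swap i k \<le> n"
  by (auto simp: swap_def)

lemma wperm_append: "wperm (u @ v) k = wperm u (wperm v k)"
  by (induction u) auto

lemma wperm_le: "w \<in> words {1..n} \<Longrightarrow> k \<le> n \<Longrightarrow> wperm w k \<le> n"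
  by (induction w) (auto simp: words_def swap_le)

section \<open>Type B relations and the loops around strands\<close>

locale type_B_generators = group G for G (structure) +
  fixes t :: "nat \<Rightarrow> 'a" and n :: nat
  assumes t_closed [simp]: "1 \<le> i \<Longrightarrow> i \<le> n \<Longrightarrow> t i \<in> carrier G"
    and t_comm: "1 \<le> i \<Longrightarrow> i + 2 \<le> j \<Longrightarrow> j \<le> n \<Longrightarrow> t i \<otimes> t j = t j \<otimes> t i"
    and t_braid: "2 \<le> i \<Longrightarrow> i < n \<Longrightarrow> t i \<otimes> (t (Suc i) \<otimes> t i) = t (Suc i) \<otimes> (t i \<otimes> t (Suc i))"
    and t_four: "2 \<le> n \<Longrightarrow> t 1 \<otimes> (t 2 \<otimes> (t 1 \<otimes> t 2)) = t 2 \<otimes> (t 1 \<otimes> (t 2 \<otimes> t 1))"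
begin

text \<open>The pure braid in which the distinguished strand 0 runs once around strand \<open>k\<close>, so that
  \<open>eta (loop k)\<close> is conjugate to \<open>\<sigma>\<^sub>k\<^sup>2\<close>; \<open>loop 0\<close> is a junk value.\<close>

fun loop :: "nat \<Rightarrow> 'a" where
  "loop 0 = \<one>"
| "loop (Suc 0) = t 1"
| "loop (Suc (Suc k)) = t (Suc (Suc k)) \<otimes> loop (Suc k) \<otimes> inv (t (Suc (Suc k)))"

lemma loop_closed [simp]: "k \<le> n \<Longrightarrow> loop k \<in> carrier G"
  by (induction k rule: loop.induct) auto

lemma loop_step:
  assumes "1 \<le> k" "k < n"
  shows "t (Suc k) \<otimes> loop k = loop (Suc k) \<otimes> t (Suc k)"
proof (cases k)
  case (Suc l)
  then show ?thesis using assms by (simp add: m_assoc)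
qed (use assms in simp)

lemma loop_comm_above:
  "k + 2 \<le> j \<Longrightarrow> j \<le> n \<Longrightarrow> t j \<otimes> loop k = loop k \<otimes> t j"
proof (induction k rule: loop.induct)
  case 2
  then show ?case using t_comm[of 1 j] by simp
next
  case (3 k)
  let ?x = "t (Suc (Suc k))"
  have x: "?x \<in> carrier G" "t j \<in> carrier G" using 3 by auto
  have c: "t j \<otimes> ?x = ?x \<otimes> t j" using 3 t_comm[of "Suc (Suc k)" j] by simp
  have ci: "t j \<otimes> inv ?x = inv ?x \<otimes> t j"
    using commute_inv[of ?x "t j"] c x by simp
  show ?case unfolding loop.simps
    using 3 c ci x by (intro intertwine_mult) auto
qed simp

text \<open>For \<open>k > m + 1\<close>, conjugation by \<open>t k\<close> reduces to
  \<open>k - 1\<close>. For \<open>k = m + 1\<close>, conjugation by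
  \<open>t (Suc m) \<otimes> t m\<close> carries \<open>loop (m - 1)\<close> to
  \<open>loop (Suc m)\<close> and \<open>t (Suc m)\<close> to \<open>t m\<close>, so
  \<open>loop_comm_above\<close> gives the claim.\<close>

lemma loop_comm_below:
  assumes "2 \<le> m" "m < k" "k \<le> n"
  shows "t m \<otimes> loop k = loop k \<otimes> t m"
  using assms
proof (induction k)
  case (Suc k)
  show ?case
  proof (cases "m = k")
    case False
    let ?y = "t (Suc k)"
    have y: "?y \<in> carrier G" "t m \<in> carrier G" "loop k \<in> carrier G" "loop (Suc k) \<in> carrier G"
      using Suc by auto
    have "t m \<otimes> ?y = ?y \<otimes> t m" using Suc.prems False t_comm[of m "Suc k"] by simp
    moreover have "t m \<otimes> loop k = loop k \<otimes> t m" using Suc False by simp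
    moreover have "?y \<otimes> loop k = loop (Suc k) \<otimes> ?y" using Suc.prems loop_step[of k] by simp
    ultimately have "(t m \<otimes> loop (Suc k)) \<otimes> ?y = (loop (Suc k) \<otimes> t m) \<otimes> ?y"
      using y by (metis m_assoc)
    then show ?thesis using y by simp
  next
    case True
    then obtain l where l: "k = Suc l" "1 \<le> l" using Suc.prems by (cases k) auto
    let ?x = "t k" and ?y = "t (Suc k)" and ?a = "loop l" and ?c = "loop (Suc k)"
    have cl: "?x \<in> carrier G" "?y \<in> carrier G" "?a \<in> carrier G" "?c \<in> carrier G" "loop k \<in> carrier G"
      using Suc.prems l True by auto
    have za: "(?y \<otimes> ?x) \<otimes> ?a = ?c \<otimes> (?y \<otimes> ?x)"
      using loop_step[of l] loop_step[of k] Suc.prems l cl by (metis Suc_lessD le_SucI m_assoc Suc_le_lessD)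
    have zy: "(?y \<otimes> ?x) \<otimes> ?y = ?x \<otimes> (?y \<otimes> ?x)"
      using t_braid[of k] Suc.prems True cl by (simp add: m_assoc)
    have ay: "?y \<otimes> ?a = ?a \<otimes> ?y" using loop_comm_above[of l "Suc k"] l Suc.prems by simp
    have "(?x \<otimes> ?c) \<otimes> (?y \<otimes> ?x) = (?y \<otimes> ?x) \<otimes> (?y \<otimes> ?a)"
      using cl za zy by (metis intertwine_mult m_closed)
    also have "\<dots> = (?c \<otimes> ?x) \<otimes> (?y \<otimes> ?x)"
      unfolding ay using cl za zy by (metis intertwine_mult m_closed)
    finally show ?thesis using cl True by (metis m_closed right_cancel)
  qed
qed simp

text \<open>Conjugation by \<open>t (Suc k) \<otimes> t (Suc (Suc k))\<close> carries
  \<open>loop k\<close> to \<open>loop (Suc k)\<close> and \<open>t (Suc k)\<close> to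
  \<open>t (Suc (Suc k))\<close>, so every instance is transported from
  \<open>t_four\<close>.\<close>

lemma loop_four:
  assumes "1 \<le> k" "k < n"
  shows "loop k \<otimes> (t (Suc k) \<otimes> (loop k \<otimes> t (Suc k))) =
    t (Suc k) \<otimes> (loop k \<otimes> (t (Suc k) \<otimes> loop k))"
  using assms
proof (induction k)
  case (Suc k)
  show ?case
  proof (cases "k = 0")
    case True
    then show ?thesis using t_four Suc.prems by (simp add: numeral_2_eq_2)
  next
    case False
    let ?x = "t (Suc k)" and ?y = "t (Suc (Suc k))" and ?a = "loop k" and ?b = "loop (Suc k)"
    let ?z = "?x \<otimes> ?y"
    have cl: "?x \<in> carrier G" "?y \<in> carrier G" "?a \<in> carrier G" "?b \<in> carrier G" "?z \<in> carrier G"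
      using Suc.prems by auto
    have ay: "?y \<otimes> ?a = ?a \<otimes> ?y" using loop_comm_above[of k "Suc (Suc k)"] Suc.prems by simp
    have st: "?x \<otimes> ?a = ?b \<otimes> ?x" using loop_step[of k] False Suc.prems by simp
    have za: "?z \<otimes> ?a = ?b \<otimes> ?z" using ay st cl by (metis m_assoc)
    have zx: "?z \<otimes> ?x = ?y \<otimes> ?z"
      using t_braid[of "Suc k"] False Suc.prems cl by (simp add: m_assoc)
    have "(?b \<otimes> (?y \<otimes> (?b \<otimes> ?y))) \<otimes> ?z = ?z \<otimes> (?a \<otimes> (?x \<otimes> (?a \<otimes> ?x)))"
      by (subst eq_commute) (intro intertwine_mult za zx m_closed cl)
    also have "\<dots> = ?z \<otimes> (?x \<otimes> (?a \<otimes> (?x \<otimes> ?a)))" using Suc False by simp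
    also have "\<dots> = (?y \<otimes> (?b \<otimes> (?y \<otimes> ?b))) \<otimes> ?z"
      by (intro intertwine_mult za zx m_closed cl)
    finally show ?thesis using cl by (metis m_closed right_cancel)
  qed
qed simp

text \<open>With the coset representatives \<open>t\<^sub>k = \<sigma>\<^sub>k \<dots> \<sigma>\<^sub>1\<close> (\<open>desc k\<close>), \<open>step i k\<close> is
  the element \<open>h\<close> with \<open>\<sigma>\<^sub>i t\<^sub>k = t\<^sub>l eta(h)\<close>, where \<open>l = swap i k\<close>.\<close>

definition step :: "nat \<Rightarrow> nat \<Rightarrow> 'a" where
  "step i k = (if k = i then loop k else if Suc k = i then \<one> else if k < i then t i else t (Suc i))"

text \<open>The value on an inverse letter is forced: a letter followed by its inverse must have
  trivial cocycle.\<close>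

definition letter :: "nat \<times> bool \<Rightarrow> nat \<Rightarrow> 'a" where
  "letter l k = (if snd l then step (fst l) k else inv (step (fst l) (swap (fst l) k)))"

text \<open>The factors collected when \<open>w\<close> is moved past a coset representative letter
  by letter from the right; each letter meets the strand to which the rest of the word has moved
  \<open>k\<close>.\<close>

primrec coc :: "nat gword \<Rightarrow> nat \<Rightarrow> 'a" where
  "coc [] k = \<one>"
| "coc (l # w) k = letter l (wperm w k) \<otimes> coc w k"

section \<open>Cocycle identity and invariance under the braid relations\<close>

lemma step_closed [simp]: "1 \<le> i \<Longrightarrow> i \<le> n \<Longrightarrow> k \<le> n \<Longrightarrow> step i k \<in> carrier G"
  by (auto simp: step_def)

lemma letter_closed: "1 \<le> fst l \<Longrightarrow> fst l \<le> n \<Longrightarrow> k \<le> n \<Longrightarrow> letter l k \<in> carrier G"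
  by (auto simp: letter_def swap_le)

lemma coc_closed: "w \<in> words {1..n} \<Longrightarrow> k \<le> n \<Longrightarrow> coc w k \<in> carrier G"
proof (induction w)
  case (Cons l w)
  then show ?case using wperm_le[of w n k] letter_closed[of l "wperm w k"]
    by (auto simp: words_def)
qed simp

lemma coc_append:
  "u \<in> words {1..n} \<Longrightarrow> v \<in> words {1..n} \<Longrightarrow> k \<le> n \<Longrightarrow>
    coc (u @ v) k = coc u (wperm v k) \<otimes> coc v k"
proof (induction u)
  case (Cons l u)
  then have "u \<in> words {1..n}" "1 \<le> fst l" "fst l \<le> n" by (auto simp: words_def)
  moreover have "wperm u (wperm v k) \<le> n"
    using calculation Cons.prems by (intro wperm_le) auto
  ultimately show ?case
    using Cons wperm_le[of v n k] coc_closed[of u "wperm v k"] coc_closed[of v k]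
      letter_closed[of l "wperm u (wperm v k)"]
    by (simp add: wperm_append m_assoc)
qed (simp add: coc_closed)

text \<open>The cases locate \<open>k\<close> relative to the two exchanged pairs. Only
  \<open>k = i\<close> and \<open>k = j\<close> produce a \<open>loop\<close>, and there the
  commutation with generators above and below it is what is needed.\<close>

lemma step_comm:
  assumes "1 \<le> i" "i + 2 \<le> j" "j \<le> n" "k \<le> n"
  shows "swap i (swap j k) = swap j (swap i k)"
    and "step i (swap j k) \<otimes> step j k = step j (swap i k) \<otimes> step i k"
proof -
  show "swap i (swap j k) = swap j (swap i k)" using assms by (auto simp: swap_def)
  consider "Suc k < i" | "Suc k = i" | "k = i" | "i < k" "Suc k < j" | "Suc k = j" | "k = j" | "j < k"
    by linarith
  then show "step i (swap j k) \<otimes> step j k = step j (swap i k) \<otimes> step i k"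
  proof cases
    case 3
    then show ?thesis using assms loop_comm_above[of i j] by (auto simp: step_def swap_def)
  next
    case 6
    then show ?thesis using assms loop_comm_below[of "Suc i" j] by (auto simp: step_def swap_def)
  qed (use assms t_comm[of i j] t_comm[of "Suc i" j] t_comm[of "Suc i" "Suc j"]
      in \<open>auto simp: step_def swap_def\<close>)
qed

text \<open>For \<open>k = i\<close> each side contains one loop and the claim is
  \<open>loop_step\<close>; for \<open>k = Suc i\<close> there are two and it reduces to
  \<open>loop_four\<close>. The other cases are trivial or braid relations.\<close>

lemma step_braid:
  assumes "1 \<le> i" "i < n" "k \<le> n"
  shows "swap i (swap (Suc i) (swap i k)) = swap (Suc i) (swap i (swap (Suc i) k))"
    and "step i (swap (Suc i) (swap i k)) \<otimes> (step (Suc i) (swap i k) \<otimes> step i k) =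
      step (Suc i) (swap i (swap (Suc i) k)) \<otimes> (step i (swap (Suc i) k) \<otimes> step (Suc i) k)"
proof -
  show "swap i (swap (Suc i) (swap i k)) = swap (Suc i) (swap i (swap (Suc i) k))"
    using assms by (auto simp: swap_def)
  consider "Suc k < i" | "Suc k = i" | "k = i" | "k = Suc i" | "Suc i < k" by linarith
  then show "step i (swap (Suc i) (swap i k)) \<otimes> (step (Suc i) (swap i k) \<otimes> step i k) =
      step (Suc i) (swap i (swap (Suc i) k)) \<otimes> (step i (swap (Suc i) k) \<otimes> step (Suc i) k)"
  proof cases
    case 3
    then show ?thesis using assms loop_step[of i] by (auto simp: step_def swap_def)
  next
    case 4
    have cl: "loop i \<in> carrier G" "t (Suc i) \<in> carrier G" "loop (Suc i) \<in> carrier G"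
      using assms by auto
    have "loop i \<otimes> (loop (Suc i) \<otimes> t (Suc i)) = t (Suc i) \<otimes> (loop i \<otimes> loop (Suc i))"
    proof -
      \<comment> \<open>After multiplying by \<open>t (Suc i)\<close> on the right,
        \<open>loop_step\<close> replaces \<open>loop (Suc i)\<close> by \<open>loop i\<close> on
        both sides and \<open>loop_four\<close> applies.\<close>
      have "(loop i \<otimes> (loop (Suc i) \<otimes> t (Suc i))) \<otimes> t (Suc i) =
          t (Suc i) \<otimes> (loop i \<otimes> (t (Suc i) \<otimes> loop i))"
        using loop_four[of i] loop_step[of i, symmetric] assms cl by (simp add: m_assoc)
      also have "\<dots> = (t (Suc i) \<otimes> (loop i \<otimes> loop (Suc i))) \<otimes> t (Suc i)"
        using loop_step[of i] assms cl by (simp add: m_assoc)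
      finally show ?thesis using cl by (metis m_closed right_cancel)
    qed
    then show ?thesis using 4 assms by (auto simp: step_def swap_def)
  qed (use assms t_braid[of i] t_braid[of "Suc i"] in \<open>auto simp: step_def swap_def\<close>)
qed

lemma coc_rels:
  assumes "(u, v) \<in> rels_A n" "k \<le> n"
  shows "wperm u k = wperm v k \<and> coc u k = coc v k"
proof -
  consider
    (comm) i j where "i \<in> {1..n}" "j \<in> {1..n}" "\<bar>int i - int j\<bar> \<ge> 2"
      "u = pos_word [i, j]" "v = pos_word [j, i]"
  | (braid) i where "1 \<le> i" "i < n" "u = pos_word [i, i+1, i]" "v = pos_word [i+1, i, i+1]"
    using assms(1) by (auto simp: rels_A_def commutation_rels_def)
  then show ?thesis
  proof cases
    case comm
    then consider "i + 2 \<le> j" | "j + 2 \<le> i" by linarith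
    then show ?thesis
      using comm assms(2) step_comm[of i j k] step_comm[of j i k]
      by cases (auto simp: pos_word_def letter_def swap_le)
  next
    case braid
    then show ?thesis
      using assms(2) step_braid[of i k] by (auto simp: pos_word_def letter_def swap_le)
  qed
qed

lemma coc_pres_eq:
  assumes "pres_eq {1..n} (rels_A n) u v" "k \<le> n"
  shows "wperm u k = wperm v k \<and> coc u k = coc v k"
  using assms
proof (induction arbitrary: k)
  case (cancel x b)
  then show ?case by (auto simp: letter_def swap_le)
next
  case (mult u u' v v')
  have w: "u \<in> words {1..n}" "u' \<in> words {1..n}" "v \<in> words {1..n}" "v' \<in> words {1..n}"
    using pres_eq_words[OF rels_A_words] mult.hyps by blast+
  then show ?case
    using mult.IH(1)[of "wperm v' k"] mult.IH(2)[of k] mult.prems wperm_le[of v' n k]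
    by (simp add: wperm_append coc_append)
qed (auto simp: coc_rels)

end

section \<open>The embedding\<close>

locale artin_embedding =
  fixes n :: nat
  assumes n_ge: "3 \<le> n"
begin

abbreviation mult_A (infixl "\<cdot>" 70) where "x \<cdot> y \<equiv> x \<otimes>\<^bsub>artin_A n\<^esub> y"
abbreviation mult_B (infixl "\<circ>" 70) where "x \<circ> y \<equiv> x \<otimes>\<^bsub>artin_B n\<^esub> y"

end

section \<open>The presented groups as instances of the two locales\<close>

sublocale artin_embedding \<subseteq> A: braid_generators "artin_A n" "sigma n" n
proof (intro braid_generators.intro braid_generators_axioms.intro group_artin_A)
  show "1 \<le> i \<Longrightarrow> i + 2 \<le> j \<Longrightarrow> j \<le> n \<Longrightarrow> sigma n i \<cdot> sigma n j = sigma n j \<cdot> sigma n i" for i j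
    using sigma_commute[of i n j] by simp
qed (use sigma_in sigma_braid in auto)

lemma tau_rel:
  assumes "(pos_word xs, pos_word ys) \<in> rels_B n"
  shows "pres_class {1..n} (rels_B n) (pos_word xs) = pres_class {1..n} (rels_B n) (pos_word ys)"
  using assms rels_B_words[of n] by (subst pres_class_eq_iff) (auto intro: pres_eq.rel)

sublocale artin_embedding \<subseteq> B: type_B_generators "artin_B n" "tau n" n
proof (intro type_B_generators.intro type_B_generators_axioms.intro group_artin_B)
  show "tau n i \<circ> tau n j = tau n j \<circ> tau n i" if "1 \<le> i" "i + 2 \<le> j" "j \<le> n" for i j
  proof -
    have "(pos_word [i, j], pos_word [j, i]) \<in> commutation_rels n"
      unfolding commutation_rels_def using that by (intro CollectI exI[of _ i] exI[of _ j]) auto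
    then have "(pos_word [i, j], pos_word [j, i]) \<in> rels_B n" by (simp add: rels_B_def)
    from tau_rel[OF this] show ?thesis
      using that by (simp add: tau_def pres_gen_def artin_B_def pos_word_def presented_mult words_def)
  qed
  show "tau n i \<circ> (tau n (Suc i) \<circ> tau n i) = tau n (Suc i) \<circ> (tau n i \<circ> tau n (Suc i))"
    if "2 \<le> i" "i < n" for i
  proof -
    have "(pos_word [i, i+1, i], pos_word [i+1, i, i+1]) \<in> rels_B n"
      using that by (auto simp: rels_B_def)
    from tau_rel[OF this] show ?thesis
      using that by (simp add: tau_def pres_gen_def artin_B_def pos_word_def presented_mult words_def)
  qed
  show "tau n 1 \<circ> (tau n 2 \<circ> (tau n 1 \<circ> tau n 2)) = tau n 2 \<circ> (tau n 1 \<circ> (tau n 2 \<circ> tau n 1))"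
    if "2 \<le> n"
  proof -
    have "(pos_word [1, 2, 1, 2], pos_word [2, 1, 2, 1]) \<in> rels_B n"
      using that by (auto simp: rels_B_def)
    from tau_rel[OF this] show ?thesis
      using that by (simp add: tau_def pres_gen_def artin_B_def pos_word_def presented_mult words_def)
  qed
qed (use tau_in in auto)

sublocale artin_embedding \<subseteq> eta: group_hom "artin_B n" "artin_A n" "eta n"
  by (intro group_hom.intro group_hom_axioms.intro group_artin_A group_artin_B eta_hom)

context artin_embedding
begin

lemma carrier_A: "carrier (artin_A n) = generate (artin_A n) (sigma n ` {1..n})"
  using presented_generate[of "{1..n}" "rels_A n"] by (simp add: artin_A_def sigma_def)

lemma carrier_B: "carrier (artin_B n) = generate (artin_B n) (tau n ` {1..n})"
  using presented_generate[of "{1..n}" "rels_B n"] by (simp add: artin_B_def tau_def)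

text \<open>The choice of representative is harmless: \<open>coc\<close> respects the relations of type A.\<close>

definition act :: "nat gword set \<Rightarrow> nat \<Rightarrow> nat" where
  "act X k = wperm (SOME w. w \<in> X) k"

definition gcoc :: "nat gword set \<Rightarrow> nat \<Rightarrow> nat gword set" where
  "gcoc X k = B.coc (SOME w. w \<in> X) k"

lemma act_gcoc_class:
  assumes "w \<in> words {1..n}" "k \<le> n"
  shows "act (pres_class {1..n} (rels_A n) w) k = wperm w k"
    and "gcoc (pres_class {1..n} (rels_A n) w) k = B.coc w k"
proof -
  have "(SOME v. v \<in> pres_class {1..n} (rels_A n) w) \<in> pres_class {1..n} (rels_A n) w"
    by (rule someI[of _ w]) (use assms in \<open>auto simp: pres_class_def intro: pres_eq.refl\<close>)
  then have "pres_eq {1..n} (rels_A n) w (SOME v. v \<in> pres_class {1..n} (rels_A n) w)"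
    by (simp add: pres_class_def)
  from B.coc_pres_eq[OF this assms(2)]
  show "act (pres_class {1..n} (rels_A n) w) k = wperm w k"
    and "gcoc (pres_class {1..n} (rels_A n) w) k = B.coc w k"
    by (auto simp: act_def gcoc_def)
qed

lemma
  assumes "X \<in> carrier (artin_A n)" "k \<le> n"
  shows act_le: "act X k \<le> n" and gcoc_closed: "gcoc X k \<in> carrier (artin_B n)"
  using assms act_gcoc_class wperm_le[of _ n k] B.coc_closed[of _ k]
  by (auto simp: artin_A_def presented_carrier)

lemma
  assumes "X \<in> carrier (artin_A n)" "Y \<in> carrier (artin_A n)" "k \<le> n"
  shows act_mult: "act (X \<cdot> Y) k = act X (act Y k)"
    and gcoc_mult: "gcoc (X \<cdot> Y) k = gcoc X (act Y k) \<circ> gcoc Y k"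
proof -
  obtain u v where uv: "u \<in> words {1..n}" "v \<in> words {1..n}"
    "X = pres_class {1..n} (rels_A n) u" "Y = pres_class {1..n} (rels_A n) v"
    using assms by (auto simp: artin_A_def presented_carrier)
  moreover have "u @ v \<in> words {1..n}" using uv by (auto simp: words_def)
  moreover have "X \<cdot> Y = pres_class {1..n} (rels_A n) (u @ v)"
    using uv by (simp add: artin_A_def presented_mult)
  ultimately show "act (X \<cdot> Y) k = act X (act Y k)"
    and "gcoc (X \<cdot> Y) k = gcoc X (act Y k) \<circ> gcoc Y k"
    using assms(3) wperm_le[of v n k]
    by (simp_all add: act_gcoc_class wperm_append B.coc_append del: One_nat_def)
qed

lemma
  assumes "k \<le> n"
  shows act_one: "act \<one>\<^bsub>artin_A n\<^esub> k = k"
    and gcoc_one: "gcoc \<one>\<^bsub>artin_A n\<^esub> k = \<one>\<^bsub>artin_B n\<^esub>"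
  using act_gcoc_class[of "[]" k] assms by (simp_all add: artin_A_def presented_one words_def del: One_nat_def)

lemma
  assumes "1 \<le> i" "i \<le> n" "k \<le> n"
  shows act_sigma: "act (sigma n i) k = swap i k"
    and gcoc_sigma: "gcoc (sigma n i) k = B.step i k"
  using act_gcoc_class[of "[(i, True)]" k] assms
  by (simp_all add: sigma_def pres_gen_def words_def B.letter_def del: One_nat_def)

lemma
  assumes "X \<in> carrier (artin_A n)" "k \<le> n"
  shows act_inv: "act (inv\<^bsub>artin_A n\<^esub> X) (act X k) = k"
    and gcoc_inv: "gcoc (inv\<^bsub>artin_A n\<^esub> X) (act X k) = inv\<^bsub>artin_B n\<^esub> (gcoc X k)"
proof -
  have X: "inv\<^bsub>artin_A n\<^esub> X \<in> carrier (artin_A n)" using assms by simp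
  show "act (inv\<^bsub>artin_A n\<^esub> X) (act X k) = k"
    using act_mult[OF X assms] assms by (simp add: act_one)
  have "gcoc (inv\<^bsub>artin_A n\<^esub> X) (act X k) \<circ> gcoc X k = \<one>\<^bsub>artin_B n\<^esub>"
    using gcoc_mult[OF X assms] assms by (simp add: gcoc_one)
  then show "gcoc (inv\<^bsub>artin_A n\<^esub> X) (act X k) = inv\<^bsub>artin_B n\<^esub> (gcoc X k)"
    using gcoc_closed[OF assms] gcoc_closed[OF X act_le[OF assms]] by (simp add: B.inv_equality)
qed

lemma
  assumes "1 \<le> i" "i \<le> n" "k \<le> n"
  shows act_inv_sigma: "act (inv\<^bsub>artin_A n\<^esub> (sigma n i)) k = swap i k"
    and gcoc_inv_sigma:
      "gcoc (inv\<^bsub>artin_A n\<^esub> (sigma n i)) k = inv\<^bsub>artin_B n\<^esub> (B.step i (swap i k))"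
  using act_inv[of "sigma n i" "swap i k"] gcoc_inv[of "sigma n i" "swap i k"] assms
  by (simp_all add: act_sigma gcoc_sigma swap_le)

text \<open>On elements fixing strand 0 the cocycle at 0 is multiplicative, so checking the
  generators is enough.\<close>

lemma act_gcoc_eta:
  assumes "g \<in> carrier (artin_B n)"
  shows "act (eta n g) 0 = 0 \<and> gcoc (eta n g) 0 = g"
proof -
  have gen: "act (eta n (tau n i)) 0 = 0 \<and> gcoc (eta n (tau n i)) 0 = tau n i"
    if i: "i \<in> {1..n}" for i
  proof (cases "i = 1")
    case True
    \<comment> \<open>The right factor takes strand 0 to 1 with trivial value; the left factor takes
      it back with value \<open>B.loop 1\<close>, which is \<open>tau n 1\<close>.\<close>
    have "eta n (tau n i) = sigma n 1 \<cdot> sigma n 1"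
      using True n_ge eta_tau1[of n] by (simp add: numeral_2_eq_2)
    then show ?thesis using n_ge True
      by (simp add: act_mult gcoc_mult act_sigma gcoc_sigma swap_def B.step_def)
  next
    case False
    then show ?thesis
      using i eta_tau[of i n] by (auto simp: act_sigma gcoc_sigma swap_def B.step_def)
  qed
  have "g \<in> generate (artin_B n) (tau n ` {1..n})" using assms carrier_B by simp
  then show ?thesis
  proof induction
    case one
    then show ?case by (simp add: act_one gcoc_one)
  next
    case (incl h)
    then show ?case using gen by auto
  next
    case (inv h)
    then have h: "h \<in> carrier (artin_B n)" by auto
    then show ?case
      using inv gen act_inv[of "eta n h" 0] gcoc_inv[of "eta n h" 0] by auto
  next
    case (eng h1 h2)
    then have "h1 \<in> carrier (artin_B n)" "h2 \<in> carrier (artin_B n)" using carrier_B by auto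
    then show ?case using eng.IH by (simp add: act_mult gcoc_mult)
  qed
qed

lemma eta_mon: "eta n \<in> mon (artin_B n) (artin_A n)"
proof -
  have "inj_on (eta n) (carrier (artin_B n))"
    by (rule inj_on_inverseI[of _ "\<lambda>X. gcoc X 0"]) (use act_gcoc_eta in blast)
  then show ?thesis using eta_hom by (simp add: mon_def)
qed

lemma act_gcoc_desc: "k \<le> n \<Longrightarrow> act (A.desc k) 0 = k \<and> gcoc (A.desc k) 0 = \<one>\<^bsub>artin_B n\<^esub>"
proof (induction k)
  case (Suc k)
  then show ?case by (simp add: act_mult gcoc_mult act_sigma gcoc_sigma swap_def B.step_def)
qed (simp add: act_one gcoc_one)

text \<open>\<open>A.desc k\<close> takes strand 0 to \<open>k\<close> with trivial cocycle, so the
  value at \<open>k\<close> can be read at 0 from the product with \<open>A.desc k\<close>. There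
  commutation swaps the factors and \<open>act_gcoc_eta\<close> applies.\<close>

lemma gcoc_eta_central:
  assumes "h \<in> carrier (artin_B n)" "k \<le> n" "eta n h \<cdot> A.desc k = A.desc k \<cdot> eta n h"
  shows "gcoc (eta n h) k = h"
proof -
  have "gcoc (eta n h) k = gcoc (eta n h \<cdot> A.desc k) 0"
    using assms(1,2) act_gcoc_desc[of k] gcoc_closed[of "eta n h" k] by (simp add: gcoc_mult)
  also have "\<dots> = h"
    using assms act_gcoc_desc[of k] act_gcoc_eta[of h] by (simp add: gcoc_mult)
  finally show ?thesis .
qed

section \<open>Garside elements and their images\<close>

lemma asc_list_prod:
  "k \<le> n \<Longrightarrow> list_prod (artin_A n) (map (sigma n) [1..<k+1]) = A.asc k"
proof (induction k)
  case (Suc k)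
  have "set (map (sigma n) [1..<k+1]) \<subseteq> carrier (artin_A n)" using Suc.prems by auto
  then show ?case using Suc A.list_prod_append[of "map (sigma n) [1..<k+1]" "[sigma n (Suc k)]"]
    by (simp add: list_prod_def)
qed (simp add: list_prod_def)

lemma gars_list_prod:
  "k \<le> n \<Longrightarrow> list_prod (artin_A n)
     (map (\<lambda>k. list_prod (artin_A n) (map (sigma n) [1..<k+1])) (rev [1..<k+1])) = A.gars k"
proof (induction k)
  case (Suc k)
  then show ?case using asc_list_prod[of "Suc k"] by (simp add: list_prod_def)
qed (simp add: list_prod_def)

lemma Delta_A_square: "Delta_A n [^]\<^bsub>artin_A n\<^esub> (2::nat) = A.gars n \<cdot> A.gars n"
  using gars_list_prod[of n] by (simp add: Delta_A_def numeral_2_eq_2)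

lemma tau_list_closed: "k \<le> n \<Longrightarrow> list_prod (artin_B n) (map (tau n) [1..<k+1]) \<in> carrier (artin_B n)"
  by (intro B.list_prod_closed) auto

lemma Delta_B_closed [simp]: "Delta_B n \<in> carrier (artin_B n)"
  unfolding Delta_B_def using tau_list_closed[of n] by simp

lemma eta_tau_list:
  "1 \<le> k \<Longrightarrow> k \<le> n \<Longrightarrow>
    eta n (list_prod (artin_B n) (map (tau n) [1..<k+1])) = sigma n 1 \<cdot> A.asc k"
proof (induction k)
  case (Suc k)
  have "set (map (tau n) [1..<k+1]) \<subseteq> carrier (artin_B n)" using Suc.prems by auto
  then have split: "list_prod (artin_B n) (map (tau n) [1..<Suc k+1]) =
      list_prod (artin_B n) (map (tau n) [1..<k+1]) \<circ> tau n (Suc k)"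
    using Suc B.list_prod_append[of "map (tau n) [1..<k+1]" "[tau n (Suc k)]"]
    by (simp add: list_prod_def)
  show ?case
  proof (cases "k = 0")
    case True
    then show ?thesis using n_ge eta_tau1[of n] by (simp add: list_prod_def numeral_2_eq_2)
  next
    case False
    then show ?thesis
      using Suc split eta_tau[of "Suc k" n] tau_list_closed[of k] by (simp add: A.m_assoc)
  qed
qed simp

lemma eta_Delta_B: "eta n (Delta_B n) = Delta_A n [^]\<^bsub>artin_A n\<^esub> (2::nat)"
proof -
  have "eta n (Delta_B n) = (sigma n 1 \<cdot> A.asc n) [^]\<^bsub>artin_A n\<^esub> n"
    unfolding Delta_B_def using eta_tau_list[of n] tau_list_closed[of n] n_ge
    by (subst eta.hom_nat_pow) auto
  then show ?thesis using A.gars_square_mixed Delta_A_square by simp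
qed

section \<open>The generating sets under \<open>eta\<close>\<close>

lemma P_A_carrier: "P_A n \<subseteq> carrier (artin_A n)"
proof -
  have "Delta_A n [^]\<^bsub>artin_A n\<^esub> (2::nat) \<in> carrier (artin_A n)" by (simp add: Delta_A_square)
  moreover have "sigma n ` {a..b} \<subseteq> carrier (artin_A n)" if "{a..b} \<subset> {1..n}" for a b
    using that sigma_in[of _ n] by blast
  ultimately show ?thesis
    unfolding P_A_def parabolics_def
    by (intro Un_least Union_least) (auto dest: A.generate_in_carrier[rotated])
qed

lemma P_B_carrier: "P_B n \<subseteq> carrier (artin_B n)"
proof -
  have "Delta_B n [^]\<^bsub>artin_B n\<^esub> (2::nat) \<in> carrier (artin_B n)" by simp
  moreover have "tau n ` {a..b} \<subseteq> carrier (artin_B n)" if "{a..b} \<subset> {1..n}" for a b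
    using that tau_in[of _ n] by blast
  ultimately show ?thesis
    unfolding P_B_def parabolics_def
    by (intro Un_least Union_least) (auto dest: B.generate_in_carrier[rotated])
qed

lemma P_A_gens: "x \<in> carrier (artin_A n) \<Longrightarrow> \<exists>ps. set ps \<subseteq> P_A n \<and> list_prod (artin_A n) ps = x"
  and P_B_gens: "x \<in> carrier (artin_B n) \<Longrightarrow> \<exists>ps. set ps \<subseteq> P_B n \<and> list_prod (artin_B n) ps = x"
  using P_A_generates[of n x] P_B_generates[of n x] n_ge by auto

lemma eta_P_B:
  assumes "p \<in> P_B n"
  shows "eta n p \<in> P_A n"
proof -
  consider a b where "a \<le> b" "{a..b} \<subset> {1..n}" "p \<in> generate (artin_B n) (tau n ` {a..b})"
    | "p \<in> generate (artin_B n) {Delta_B n [^]\<^bsub>artin_B n\<^esub> (2::nat)}"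
    using assms by (auto simp: P_B_def parabolics_def)
  then show ?thesis
  proof cases
    case 1
    have sub: "tau n ` {a..b} \<subseteq> carrier (artin_B n)" using 1(2) tau_in[of _ n] by blast
    have s: "sigma n ` {a..b} \<subseteq> carrier (artin_A n)" using 1(2) sigma_in[of _ n] by blast
    have "eta n (tau n i) \<in> generate (artin_A n) (sigma n ` {a..b})" if i: "i \<in> {a..b}" for i
    proof -
      have "i \<in> {1..n}" using i 1(2) by blast
      moreover have si: "sigma n i \<in> generate (artin_A n) (sigma n ` {a..b})"
        using i by (auto intro: generate.incl)
      ultimately show ?thesis
        using eta_tau[of i n] eta_tau1[of n] generate.eng[OF si si]
        by (cases "i = 1") (auto simp: numeral_2_eq_2)
    qed
    then have "generate (artin_A n) (eta n ` tau n ` {a..b}) \<subseteq> generate (artin_A n) (sigma n ` {a..b})"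
      using A.generate_is_subgroup[OF s] by (intro A.generate_subgroup_incl) auto
    then have "eta n p \<in> generate (artin_A n) (sigma n ` {a..b})"
      using eta.generate_img[OF sub] 1(3) by blast
    then show ?thesis using 1 by (auto simp: P_A_def parabolics_def)
  next
    case 2
    let ?z = "Delta_A n [^]\<^bsub>artin_A n\<^esub> (2::nat)"
    have z: "?z \<in> carrier (artin_A n)" by (simp add: Delta_A_square)
    have "?z \<in> generate (artin_A n) {?z}" by (auto intro: generate.incl)
    then have "?z \<cdot> ?z \<in> generate (artin_A n) {?z}" by (intro generate.eng)
    \<comment> \<open>\<open>eta\<close> takes \<open>Delta_B n\<close> itself to \<open>?z\<close>,
      so its square goes to the square of \<open>?z\<close>.\<close>
    moreover have "eta n (Delta_B n [^]\<^bsub>artin_B n\<^esub> (2::nat)) = ?z \<cdot> ?z"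
      using eta.hom_mult[OF Delta_B_closed Delta_B_closed] eta_Delta_B by (simp add: numeral_2_eq_2)
    ultimately have "generate (artin_A n) (eta n ` {Delta_B n [^]\<^bsub>artin_B n\<^esub> (2::nat)}) \<subseteq>
        generate (artin_A n) {?z}"
      using A.generate_is_subgroup[of "{?z}"] z by (intro A.generate_subgroup_incl) auto
    then show ?thesis
      using 2 eta.generate_img[of "{Delta_B n [^]\<^bsub>artin_B n\<^esub> (2::nat)}"]
      by (auto simp: P_A_def)
  qed
qed

section \<open>Bounds for the cocycle and the quasi-isometry\<close>

lemma loop_generate:
  "1 \<le> k \<Longrightarrow> k \<le> m \<Longrightarrow> B.loop k \<in> generate (artin_B n) (tau n ` {1..m})"
proof (induction k rule: B.loop.induct)
  case (3 k)
  then have "tau n (Suc (Suc k)) \<in> tau n ` {1..m}"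
    and "B.loop (Suc k) \<in> generate (artin_B n) (tau n ` {1..m})" by auto
  then show ?case unfolding B.loop.simps by (blast intro: generate.eng generate.inv generate.incl)
qed (auto intro: generate.incl)

text \<open>The value \<open>tau n (Suc i)\<close> occurs only for \<open>i < k\<close>, and then
  \<open>k < n\<close> keeps its index below \<open>n\<close>.\<close>

lemma step_generate_low:
  assumes "1 \<le> i" "i < n" "k < n"
  shows "B.step i k \<in> generate (artin_B n) (tau n ` {1..n-1})"
  using assms loop_generate[of k "n - 1"] unfolding B.step_def
  by (auto intro: generate.one generate.incl)

lemma step_generate_high:
  assumes "1 \<le> i" "i < n"
  shows "B.step i n \<in> generate (artin_B n) (tau n ` {2..n})"
  using assms unfolding B.step_def by (auto intro!: generate.incl)

text \<open>These generators fix strand \<open>n\<close> and permute the others, so there are two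
  invariant sets of strands. On each, confinement of the cocycle to a parabolic subgroup passes from
  generators to products and inverses.\<close>

lemma gcoc_low_parabolic:
  assumes "p \<in> generate (artin_A n) (sigma n ` {1..n-1})"
  shows "k < n \<Longrightarrow> act p k < n \<and> gcoc p k \<in> generate (artin_B n) (tau n ` {1..n-1})"
    and "act p n = n \<and> gcoc p n \<in> generate (artin_B n) (tau n ` {2..n})"
proof -
  have sub: "tau n ` {1..n-1} \<subseteq> carrier (artin_B n)" "tau n ` {2..n} \<subseteq> carrier (artin_B n)"
    by auto
  have gensub: "generate (artin_A n) (sigma n ` {1..n-1}) \<subseteq> carrier (artin_A n)"
    by (rule A.generate_incl) auto
  have "(\<forall>k<n. act p k < n \<and> gcoc p k \<in> generate (artin_B n) (tau n ` {1..n-1})) \<and>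
      act p n = n \<and> gcoc p n \<in> generate (artin_B n) (tau n ` {2..n})"
    using assms
  proof induction
    case one
    then show ?case by (auto simp: act_one gcoc_one intro: generate.one)
  next
    case (incl h)
    then obtain i where i: "h = sigma n i" "1 \<le> i" "i < n" by auto
    then show ?case
      using step_generate_low[of i] step_generate_high[of i]
      by (auto simp: act_sigma gcoc_sigma) (auto simp: swap_def)
  next
    case (inv h)
    then obtain i where i: "h = sigma n i" "1 \<le> i" "i < n" by auto
    have s: "swap i k < n" if "k < n" for k using i that by (auto simp: swap_def)
    have sn: "swap i n = n" using i by (auto simp: swap_def)
    show ?case
      using i s sn step_generate_low[of i] step_generate_high[of i]
        B.generate_m_inv_closed[OF sub(1)] B.generate_m_inv_closed[OF sub(2)]
      by (auto simp: act_inv_sigma gcoc_inv_sigma)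
  next
    case (eng h1 h2)
    then have "h1 \<in> carrier (artin_A n)" "h2 \<in> carrier (artin_A n)" using gensub by auto
    then show ?case using eng.IH by (auto simp: act_mult gcoc_mult intro: generate.eng)
  qed
  then show "k < n \<Longrightarrow> act p k < n \<and> gcoc p k \<in> generate (artin_B n) (tau n ` {1..n-1})"
    and "act p n = n \<and> gcoc p n \<in> generate (artin_B n) (tau n ` {2..n})" by auto
qed

lemma parabolic_P_B:
  assumes "a \<le> b" "{a..b} \<subset> {1..n}"
  shows "generate (artin_B n) (tau n ` {a..b}) \<subseteq> P_B n"
proof -
  have "generate (artin_B n) (tau n ` {a..b}) \<in> parabolics (artin_B n) n (tau n)"
    unfolding parabolics_def using assms by blast
  then show ?thesis unfolding P_B_def by blast
qed

lemma gcoc_low_P_B: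
  assumes "p \<in> generate (artin_A n) (sigma n ` {1..n-1})" "k \<le> n"
  shows "gcoc p k \<in> P_B n"
proof -
  have "n \<in> {1..n}" "n \<notin> {1..n-1}" "1 \<in> {1..n}" "1 \<notin> {2..n}" using n_ge by auto
  moreover have "{1..n-1} \<subseteq> {1..n}" "{2..n} \<subseteq> {1..n}" "1 \<le> n - 1" "2 \<le> n" using n_ge by auto
  ultimately have "generate (artin_B n) (tau n ` {1..n-1}) \<subseteq> P_B n"
    "generate (artin_B n) (tau n ` {2..n}) \<subseteq> P_B n"
    by (metis parabolic_P_B psubsetI)+
  then show ?thesis
    using gcoc_low_parabolic[OF assms(1)] assms(2) by (cases "k = n") (auto dest!: le_neq_implies_less)
qed

lemma high_parabolic_conj:
  assumes "p \<in> generate (artin_A n) (sigma n ` {2..n})"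
  shows "inv\<^bsub>artin_A n\<^esub> (A.asc n) \<cdot> p \<cdot> A.asc n \<in> generate (artin_A n) (sigma n ` {1..n-1})"
proof -
  let ?d = "A.asc n" and ?H = "generate (artin_A n) (sigma n ` {1..n-1})"
  have sub: "sigma n ` {1..n-1} \<subseteq> carrier (artin_A n)" "sigma n ` {2..n} \<subseteq> carrier (artin_A n)"
    by auto
  have conj: "inv\<^bsub>artin_A n\<^esub> ?d \<cdot> sigma n i \<cdot> ?d \<in> sigma n ` {1..n-1}" if i: "i \<in> {2..n}" for i
  proof -
    have "?d \<cdot> sigma n (i - 1) = sigma n i \<cdot> ?d"
      using i A.asc_shift[of "i - 1" n] by (auto simp: Suc_diff_le numeral_2_eq_2)
    then have "inv\<^bsub>artin_A n\<^esub> ?d \<cdot> sigma n i \<cdot> ?d = inv\<^bsub>artin_A n\<^esub> ?d \<cdot> (?d \<cdot> sigma n (i - 1))"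
      using i by (simp add: A.m_assoc)
    also have "\<dots> = sigma n (i - 1)" using sigma_in[of "i - 1" n] i by (intro A.inv_mult_cancel) auto
    finally show ?thesis using i by (auto intro!: imageI)
  qed
  show ?thesis using assms
  proof induction
    case one
    then show ?case by (auto intro: generate.one)
  next
    case (incl h)
    then show ?case using conj by (auto intro: generate.incl)
  next
    case (inv h)
    then have h: "h \<in> carrier (artin_A n)" using sub by blast
    have "inv\<^bsub>artin_A n\<^esub> (inv\<^bsub>artin_A n\<^esub> ?d \<cdot> h \<cdot> ?d) \<in> ?H"
      using inv conj by (intro generate.inv) auto
    then show ?case using h by (simp add: A.inv_mult_group A.m_assoc)
  next
    case (eng h1 h2)
    then have h: "h1 \<in> carrier (artin_A n)" "h2 \<in> carrier (artin_A n)"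
      using A.generate_in_carrier[OF sub(2)] by auto
    have "(inv\<^bsub>artin_A n\<^esub> ?d \<cdot> h1 \<cdot> ?d) \<cdot> (inv\<^bsub>artin_A n\<^esub> ?d \<cdot> h2 \<cdot> ?d) =
        inv\<^bsub>artin_A n\<^esub> ?d \<cdot> (h1 \<cdot> (?d \<cdot> (inv\<^bsub>artin_A n\<^esub> ?d \<cdot> (h2 \<cdot> ?d))))"
      using h by (simp add: A.m_assoc)
    also have "\<dots> = inv\<^bsub>artin_A n\<^esub> ?d \<cdot> (h1 \<cdot> h2) \<cdot> ?d"
      using h by (simp add: A.mult_inv_cancel A.m_assoc)
    finally show ?case using generate.eng[OF eng.IH] by simp
  qed
qed

lemma Delta_A_square_central:
  assumes "p \<in> generate (artin_A n) {Delta_A n [^]\<^bsub>artin_A n\<^esub> (2::nat)}" "x \<in> carrier (artin_A n)"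
  shows "p \<cdot> x = x \<cdot> p"
proof -
  let ?z = "Delta_A n [^]\<^bsub>artin_A n\<^esub> (2::nat)"
  have z: "?z \<in> carrier (artin_A n)" by (simp add: Delta_A_square)
  have "?z \<cdot> sigma n i = sigma n i \<cdot> ?z" if "i \<in> {1..n}" for i
    using that A.gars_square_central[of i] by (simp add: Delta_A_square)
  then have "x \<cdot> ?z = ?z \<cdot> x"
    using z assms(2) carrier_A by (intro A.commute_generate[of x "sigma n ` {1..n}"]) auto
  then show ?thesis
    using z assms by (intro A.commute_generate[of p "{?z}"]) auto
qed

lemma gcoc_P_A_bounded: "\<exists>L. \<forall>p\<in>P_A n. \<forall>k\<le>n. gcoc p k \<in> B.word_ball (P_B n) L"
proof -
  let ?d = "A.asc n" and ?di = "inv\<^bsub>artin_A n\<^esub> (A.asc n)"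
  let ?D = "Delta_B n"
  obtain m1 where m1: "\<forall>k\<le>n. gcoc ?d k \<in> B.word_ball (P_B n) m1"
    using B.word_ball_bounded[OF P_B_gens, of n "gcoc ?d"] gcoc_closed[of ?d] by auto
  obtain m2 where m2: "\<forall>k\<le>n. gcoc ?di k \<in> B.word_ball (P_B n) m2"
    using B.word_ball_bounded[OF P_B_gens, of n "gcoc ?di"] gcoc_closed[of ?di] by auto
  \<comment> \<open>A constant family: only some ball containing \<open>?D\<close> is
    wanted.\<close>
  obtain m3 where m3: "\<forall>k\<le>n. ?D \<in> B.word_ball (P_B n) m3"
    using B.word_ball_bounded[OF P_B_gens, of n "\<lambda>k. ?D"] by auto
  have one: "x \<in> B.word_ball (P_B n) 1" if "x \<in> P_B n" for x
    using B.word_ball_incl[OF P_B_carrier that] .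
  have low: "gcoc p k \<in> B.word_ball (P_B n) 1"
    if "p \<in> generate (artin_A n) (sigma n ` {1..n-1})" "k \<le> n" for p k
    using gcoc_low_P_B[OF that] one by blast
  have sub: "sigma n ` {1..n-1} \<subseteq> carrier (artin_A n)" "sigma n ` {2..n} \<subseteq> carrier (artin_A n)"
    by auto
  have high: "gcoc p k \<in> B.word_ball (P_B n) (m1 + (1 + m2))"
    if p: "p \<in> generate (artin_A n) (sigma n ` {2..n})" "k \<le> n" for p k
  proof -
    define q where "q = ?di \<cdot> p \<cdot> ?d"
    have q: "q \<in> generate (artin_A n) (sigma n ` {1..n-1})"
      unfolding q_def by (rule high_parabolic_conj[OF p(1)])
    have c: "p \<in> carrier (artin_A n)" "q \<in> carrier (artin_A n)"
      using A.generate_in_carrier[OF sub(2) p(1)] A.generate_in_carrier[OF sub(1) q] by auto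
    \<comment> \<open>The cocycle of \<open>p\<close> splits into values on \<open>?d\<close>,
      \<open>q\<close> and \<open>?di\<close> at the strands met on the way, whence the radius
      \<open>m1 + (1 + m2)\<close>.\<close>
    have "p = ?d \<cdot> (q \<cdot> ?di)" using c by (simp add: q_def A.m_assoc A.mult_inv_cancel)
    then have "gcoc p k = gcoc ?d (act q (act ?di k)) \<circ> (gcoc q (act ?di k) \<circ> gcoc ?di k)"
      using c p(2) act_le by (simp add: gcoc_mult act_mult)
    moreover have "act ?di k \<le> n" "act q (act ?di k) \<le> n" using c p(2) act_le by simp_all
    ultimately show ?thesis
      using m1 m2 low[OF q] p(2) by (simp only:) (blast intro: B.word_ball_mult[OF P_B_carrier])
  qed
  have central: "gcoc p k \<in> B.word_ball (P_B n) (1 + m3)"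
    if p: "p \<in> generate (artin_A n) {Delta_A n [^]\<^bsub>artin_A n\<^esub> (2::nat)}" "k \<le> n" for p k
  proof -
    have "generate (artin_A n) {Delta_A n [^]\<^bsub>artin_A n\<^esub> (2::nat)} = eta n ` generate (artin_B n) {?D}"
      using eta.generate_img[of "{?D}"] eta_Delta_B by simp
    then obtain h where h: "h \<in> generate (artin_B n) {?D}" "p = eta n h" using p(1) by auto
    then obtain j :: int where j: "h = ?D [^]\<^bsub>artin_B n\<^esub> j" using B.generate_pow[of ?D] by auto
    have "gcoc p k = h"
      using gcoc_eta_central[of h k] Delta_A_square_central[OF p(1), of "A.desc k"] j h(2) p(2) by simp
    \<comment> \<open>\<open>P_B n\<close> provides the powers of the square of \<open>?D\<close>,
      but \<open>h\<close> is an arbitrary power of \<open>?D\<close>; an odd exponent costs one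
      extra factor \<open>?D\<close>, of length at most \<open>m3\<close>.\<close>
    moreover have "h = (?D [^]\<^bsub>artin_B n\<^esub> (2::nat)) [^]\<^bsub>artin_B n\<^esub> (j div 2) \<circ>
        ?D [^]\<^bsub>artin_B n\<^esub> (j mod 2)"
    proof -
      have "(?D [^]\<^bsub>artin_B n\<^esub> (2::nat)) [^]\<^bsub>artin_B n\<^esub> (j div 2) =
          ?D [^]\<^bsub>artin_B n\<^esub> (2 * (j div 2))"
        using B.int_pow_pow[of ?D 2 "j div 2"] int_pow_int[of "artin_B n" ?D 2] by simp
      then show ?thesis using j B.int_pow_mult[of ?D "2 * (j div 2)" "j mod 2"] by simp
    qed
    moreover have "(?D [^]\<^bsub>artin_B n\<^esub> (2::nat)) [^]\<^bsub>artin_B n\<^esub> (j div 2) \<in> P_B n"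
      using B.generate_pow[of "?D [^]\<^bsub>artin_B n\<^esub> (2::nat)"] by (auto simp: P_B_def)
    moreover have "?D [^]\<^bsub>artin_B n\<^esub> (j mod 2) \<in> B.word_ball (P_B n) m3"
    proof -
      have "j mod 2 = 0 \<or> j mod 2 = 1" by auto
      then show ?thesis using m3 B.word_ball_one by auto
    qed
    ultimately show ?thesis using B.word_ball_mult[OF P_B_carrier one] by metis
  qed
  \<comment> \<open>A common bound for the radii \<open>1\<close>, \<open>m1 + (1 + m2)\<close> and
    \<open>1 + m3\<close>.\<close>
  have "gcoc p k \<in> B.word_ball (P_B n) (m1 + m2 + m3 + 1)" if p: "p \<in> P_A n" "k \<le> n" for p k
  proof -
    consider a b where "a \<le> b" "{a..b} \<subset> {1..n}" "p \<in> generate (artin_A n) (sigma n ` {a..b})"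
      | "p \<in> generate (artin_A n) {Delta_A n [^]\<^bsub>artin_A n\<^esub> (2::nat)}"
      using p by (auto simp: P_A_def parabolics_def)
    then show ?thesis
    proof cases
      case 1
      have "1 \<le> a" "b \<le> n" using 1(1,2) by auto
      moreover have "\<not> (a = 1 \<and> b = n)" using 1(2) by auto
      ultimately consider "{a..b} \<subseteq> {1..n-1}" | "{a..b} \<subseteq> {2..n}" by force
      then show ?thesis
      proof cases
        case 1
        then have "p \<in> generate (artin_A n) (sigma n ` {1..n-1})"
          using A.mono_generate[of "sigma n ` {a..b}" "sigma n ` {1..n-1}"]
            \<open>p \<in> generate (artin_A n) (sigma n ` {a..b})\<close> by blast
        then show ?thesis using B.word_ball_mono[OF low] p(2) by simp
      next
        case 2
        then have "p \<in> generate (artin_A n) (sigma n ` {2..n})"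
          using A.mono_generate[of "sigma n ` {a..b}" "sigma n ` {2..n}"]
            \<open>p \<in> generate (artin_A n) (sigma n ` {a..b})\<close> by blast
        then show ?thesis using B.word_ball_mono[OF high] p(2) by simp
      qed
    next
      case 2
      then show ?thesis using B.word_ball_mono[OF central] p(2) by simp
    qed
  qed
  then show ?thesis by blast
qed

text \<open>Each factor is evaluated at the strand to which the factors on its right have moved
  \<open>k\<close>; hence \<open>L\<close> must be uniform in the strand.\<close>

lemma gcoc_list_prod_bounded:
  assumes L: "\<And>p k. p \<in> P_A n \<Longrightarrow> k \<le> n \<Longrightarrow> gcoc p k \<in> B.word_ball (P_B n) L"
    and "set ps \<subseteq> P_A n" "k \<le> n"
  shows "gcoc (list_prod (artin_A n) ps) k \<in> B.word_ball (P_B n) (L * length ps)"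
  using assms(2)
proof (induction ps)
  case Nil
  then show ?case using assms(3) B.word_ball_one by (simp add: list_prod_def gcoc_one)
next
  case (Cons p ps)
  let ?q = "list_prod (artin_A n) ps"
  have c: "p \<in> carrier (artin_A n)" "?q \<in> carrier (artin_A n)"
    using Cons.prems P_A_carrier by (auto intro!: A.list_prod_closed)
  have "list_prod (artin_A n) (p # ps) = p \<cdot> ?q" by (simp add: list_prod_def)
  then show ?case
    using Cons L[of p "act ?q k"] c assms(3) act_le[OF c(2) assms(3)]
      B.word_ball_mult[OF P_B_carrier, of "gcoc p (act ?q k)" L "gcoc ?q k" "L * length ps"]
    by (simp add: gcoc_mult)
qed

section \<open>Coset representatives for the image of \<open>eta\<close>\<close>

lemma square_desc:
  "1 \<le> k \<Longrightarrow> k \<le> n \<Longrightarrow> \<exists>h\<in>carrier (artin_B n).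
    sigma n k \<cdot> A.desc k = A.desc (k - 1) \<cdot> eta n h"
proof (induction k)
  case (Suc k)
  show ?case
  proof (cases "k = 0")
    case True
    then have "sigma n (Suc k) \<cdot> A.desc (Suc k) = A.desc k \<cdot> eta n (tau n 1)"
      using n_ge eta_tau1[of n] by (simp add: numeral_2_eq_2)
    then show ?thesis using n_ge tau_in[of 1 n] by auto
  next
    case False
    then obtain l where l: "k = Suc l" by (cases k) auto
    let ?x = "sigma n k" and ?y = "sigma n (Suc k)" and ?d = "A.desc l"
    \<comment> \<open>The element for \<open>Suc k\<close> will be this \<open>h\<close> conjugated
      by \<open>tau n (Suc k)\<close>, the same recursion as for \<open>loop\<close>.\<close>
    obtain h where h: "h \<in> carrier (artin_B n)" "?x \<cdot> (?x \<cdot> ?d) = ?d \<cdot> eta n h"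
      using Suc False l by auto
    let ?e = "eta n h" and ?yi = "inv\<^bsub>artin_A n\<^esub> (sigma n (Suc k))"
    have cl: "?x \<in> carrier (artin_A n)" "?y \<in> carrier (artin_A n)" "?d \<in> carrier (artin_A n)"
      "?e \<in> carrier (artin_A n)" using Suc.prems l h by auto
    have dy: "?d \<cdot> ?y = ?y \<cdot> ?d" using A.desc_comm[of l "Suc k"] l Suc.prems by simp
    have br: "?x \<cdot> (?y \<cdot> ?x) = ?y \<cdot> (?x \<cdot> ?y)" using A.s_braid[of k] l Suc.prems by simp
    \<comment> \<open>An extra \<open>?y\<close> on the right slides past \<open>?d\<close>; two
      braid moves then expose \<open>?x \<cdot> (?x \<cdot> ?d)\<close>, which is rewritten by the
      choice of \<open>h\<close>.\<close>
    have "(?y \<cdot> (?y \<cdot> (?x \<cdot> ?d))) \<cdot> ?y = ?y \<cdot> ((?y \<cdot> (?x \<cdot> ?y)) \<cdot> ?d)"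
      using cl dy by (simp add: A.m_assoc)
    also have "\<dots> = ?y \<cdot> ((?x \<cdot> (?y \<cdot> ?x)) \<cdot> ?d)" by (simp only: br)
    also have "\<dots> = (?y \<cdot> (?x \<cdot> ?y)) \<cdot> (?x \<cdot> ?d)" using cl by (simp add: A.m_assoc)
    also have "\<dots> = (?x \<cdot> (?y \<cdot> ?x)) \<cdot> (?x \<cdot> ?d)" by (simp only: br)
    also have "\<dots> = ?x \<cdot> (?y \<cdot> (?x \<cdot> (?x \<cdot> ?d)))" using cl by (simp add: A.m_assoc)
    also have "\<dots> = ?x \<cdot> ((?d \<cdot> ?y) \<cdot> ?e)" using cl by (simp add: h(2) dy A.m_assoc)
    finally have "(?y \<cdot> (?y \<cdot> (?x \<cdot> ?d))) \<cdot> ?y = (?x \<cdot> ?d) \<cdot> (?y \<cdot> ?e)"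
      using cl by (simp add: A.m_assoc)
    then have "?y \<cdot> (?y \<cdot> (?x \<cdot> ?d)) = (?x \<cdot> ?d) \<cdot> (?y \<cdot> ?e) \<cdot> ?yi"
      using cl by (simp add: A.inv_solve_right)
    moreover have t: "tau n (Suc k) \<in> carrier (artin_B n)" "eta n (tau n (Suc k)) = ?y"
      using Suc.prems l eta_tau[of "Suc k" n] by auto
    ultimately have "sigma n (Suc k) \<cdot> A.desc (Suc k) =
        A.desc k \<cdot> eta n (tau n (Suc k) \<circ> h \<circ> inv\<^bsub>artin_B n\<^esub> (tau n (Suc k)))"
      using cl h(1) l by (simp add: A.m_assoc)
    then show ?thesis using t h(1) by (metis B.inv_closed B.m_closed diff_Suc_1)
  qed
qed simp

text \<open>The cases follow the branches of \<open>step\<close>. This time the rewriting is an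
  identity in the braid group itself, from which the covering by cosets follows.\<close>

lemma sigma_desc:
  assumes "1 \<le> i" "i \<le> n" "k \<le> n"
  shows "\<exists>h\<in>carrier (artin_B n). sigma n i \<cdot> A.desc k = A.desc (swap i k) \<cdot> eta n h"
proof -
  consider "k = i" | "Suc k = i" | "Suc k < i" | "i < k" by linarith
  then show ?thesis
  proof cases
    case 1
    then show ?thesis using square_desc[of i] assms by (simp add: swap_def)
  next
    case 2
    then have "sigma n i \<cdot> A.desc k = A.desc (swap i k) \<cdot> eta n \<one>\<^bsub>artin_B n\<^esub>"
      using assms by (auto simp: swap_def)
    then show ?thesis by blast
  next
    case 3
    then have "sigma n i \<cdot> A.desc k = A.desc (swap i k) \<cdot> eta n (tau n i)"
      using assms A.desc_comm[of k i] eta_tau[of i n] by (simp add: swap_def)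
    then show ?thesis using assms by auto
  next
    case 4
    then have "sigma n i \<cdot> A.desc k = A.desc (swap i k) \<cdot> eta n (tau n (Suc i))"
      using assms A.desc_shift[of i k] eta_tau[of "Suc i" n] by (simp add: swap_def)
    moreover have "tau n (Suc i) \<in> carrier (artin_B n)" using assms 4 by simp
    ultimately show ?thesis by blast
  qed
qed

text \<open>Stated for all \<open>k\<close> because in a product the left factor meets the
  representative produced by the right one.\<close>

lemma desc_transversal:
  assumes "y \<in> carrier (artin_A n)" "k \<le> n"
  shows "\<exists>l\<le>n. \<exists>h\<in>carrier (artin_B n). y \<cdot> A.desc k = A.desc l \<cdot> eta n h"
proof -
  have "y \<in> generate (artin_A n) (sigma n ` {1..n})" using assms(1) carrier_A by simp
  then show ?thesis using assms(2)
  proof (induction arbitrary: k)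
    case one
    then show ?case by (intro exI[of _ k] conjI bexI[of _ "\<one>\<^bsub>artin_B n\<^esub>"]) auto
  next
    case (incl g)
    then obtain i where "g = sigma n i" "1 \<le> i" "i \<le> n" by auto
    then show ?case using sigma_desc[of i k] incl.prems swap_le[of i n k] by blast
  next
    case (inv g)
    then obtain i where i: "g = sigma n i" "1 \<le> i" "i \<le> n" by auto
    have sw: "swap i k \<le> n" "swap i (swap i k) = k" using i inv.prems by (auto simp: swap_le)
    obtain h where h: "h \<in> carrier (artin_B n)"
      "g \<cdot> A.desc (swap i k) = A.desc k \<cdot> eta n h"
      using sigma_desc[of i "swap i k"] i sw by auto
    have cl: "g \<in> carrier (artin_A n)" "A.desc k \<in> carrier (artin_A n)"
      "A.desc (swap i k) \<in> carrier (artin_A n)" "eta n h \<in> carrier (artin_A n)"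
      using i sw h inv.prems by auto
    have "A.desc k = g \<cdot> A.desc (swap i k) \<cdot> inv\<^bsub>artin_A n\<^esub> (eta n h)"
      using h(2) cl by (simp add: A.m_assoc)
    then have "inv\<^bsub>artin_A n\<^esub> g \<cdot> A.desc k =
        inv\<^bsub>artin_A n\<^esub> g \<cdot> (g \<cdot> (A.desc (swap i k) \<cdot> inv\<^bsub>artin_A n\<^esub> (eta n h)))"
      using cl by (simp add: A.m_assoc)
    also have "\<dots> = A.desc (swap i k) \<cdot> eta n (inv\<^bsub>artin_B n\<^esub> h)"
      using cl h(1) by (simp add: A.m_assoc[symmetric])
    finally show ?case using sw h(1) by (metis B.inv_closed)
  next
    case (eng g1 g2)
    obtain l1 h1 where 1: "l1 \<le> n" "h1 \<in> carrier (artin_B n)" "g2 \<cdot> A.desc k = A.desc l1 \<cdot> eta n h1"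
      using eng.IH(2)[OF eng.prems] by blast
    obtain l2 h2 where 2: "l2 \<le> n" "h2 \<in> carrier (artin_B n)" "g1 \<cdot> A.desc l1 = A.desc l2 \<cdot> eta n h2"
      using eng.IH(1)[OF 1(1)] by blast
    have c: "g1 \<in> carrier (artin_A n)" "g2 \<in> carrier (artin_A n)" using eng carrier_A by auto
    have "(g1 \<cdot> g2) \<cdot> A.desc k = (g1 \<cdot> A.desc l1) \<cdot> eta n h1"
      using c eng.prems 1 by (simp add: A.m_assoc)
    also have "\<dots> = A.desc l2 \<cdot> eta n (h2 \<circ> h1)"
      using c 1 2 by (simp add: A.m_assoc)
    finally show ?case using 1 2 by blast
  qed
qed

section \<open>Comparison of the two word metrics\<close>

lemma eta_list_prod:
  "set ps \<subseteq> carrier (artin_B n) \<Longrightarrow>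
    eta n (list_prod (artin_B n) ps) = list_prod (artin_A n) (map (eta n) ps)"
proof (induction ps)
  case (Cons p ps)
  then show ?case using B.list_prod_closed[of ps] by (simp add: list_prod_def)
qed (simp add: list_prod_def)

lemma eta_dist_le:
  assumes "x \<in> carrier (artin_B n)" "y \<in> carrier (artin_B n)"
  shows "word_dist (artin_A n) (P_A n) (eta n x) (eta n y) \<le> word_dist (artin_B n) (P_B n) x y"
proof -
  obtain ps where ps: "set ps \<subseteq> P_B n" "length ps = word_dist (artin_B n) (P_B n) x y"
    "list_prod (artin_B n) ps = inv\<^bsub>artin_B n\<^esub> x \<circ> y"
    using B.word_dist_attained[OF P_B_gens assms] by blast
  have "list_prod (artin_A n) (map (eta n) ps) = inv\<^bsub>artin_A n\<^esub> (eta n x) \<cdot> eta n y"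
    using eta_list_prod[of ps] ps P_B_carrier assms by auto
  moreover have "set (map (eta n) ps) \<subseteq> P_A n" using ps(1) eta_P_B by auto
  ultimately have "inv\<^bsub>artin_A n\<^esub> (eta n x) \<cdot> eta n y \<in> A.word_ball (P_A n) (length ps)"
    unfolding A.word_ball_def by (metis (mono_tags, lifting) length_map mem_Collect_eq order_refl)
  then show ?thesis using ps(2) A.word_dist_le by metis
qed

text \<open>On a shortest word between the images, the cocycle at strand 0 recovers the difference
  of \<open>x\<close> and \<open>y\<close>, and each letter contributes at most
  \<open>L\<close>.\<close>

lemma eta_dist_ge:
  "\<exists>L. \<forall>x\<in>carrier (artin_B n). \<forall>y\<in>carrier (artin_B n).
    word_dist (artin_B n) (P_B n) x y \<le> L * word_dist (artin_A n) (P_A n) (eta n x) (eta n y)"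
proof -
  obtain L where L: "\<And>p k. p \<in> P_A n \<Longrightarrow> k \<le> n \<Longrightarrow> gcoc p k \<in> B.word_ball (P_B n) L"
    using gcoc_P_A_bounded by blast
  have "word_dist (artin_B n) (P_B n) x y \<le> L * word_dist (artin_A n) (P_A n) (eta n x) (eta n y)"
    if xy: "x \<in> carrier (artin_B n)" "y \<in> carrier (artin_B n)" for x y
  proof -
    obtain ps where ps: "set ps \<subseteq> P_A n"
      "length ps = word_dist (artin_A n) (P_A n) (eta n x) (eta n y)"
      "list_prod (artin_A n) ps = inv\<^bsub>artin_A n\<^esub> (eta n x) \<cdot> eta n y"
      using A.word_dist_attained[OF P_A_gens, of "eta n x" "eta n y"] xy by auto
    have "list_prod (artin_A n) ps = eta n (inv\<^bsub>artin_B n\<^esub> x \<circ> y)"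
      using ps(3) xy by simp
    then have "inv\<^bsub>artin_B n\<^esub> x \<circ> y = gcoc (list_prod (artin_A n) ps) 0"
      using act_gcoc_eta[of "inv\<^bsub>artin_B n\<^esub> x \<circ> y"] xy by simp
    then show ?thesis
      using gcoc_list_prod_bounded[of L ps 0, OF L ps(1)] ps(2)
      by (intro B.word_dist_le) simp
  qed
  then show ?thesis by blast
qed

lemma eta_coarsely_surjective:
  "\<exists>m. \<forall>y\<in>carrier (artin_A n). \<exists>x\<in>carrier (artin_B n).
    word_dist (artin_A n) (P_A n) (eta n x) y \<le> m"
proof -
  obtain m where m: "\<forall>k\<le>n. inv\<^bsub>artin_A n\<^esub> (A.desc k) \<in> A.word_ball (P_A n) m"
    using A.word_ball_bounded[OF P_A_gens, of n "\<lambda>k. inv\<^bsub>artin_A n\<^esub> (A.desc k)"] by auto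
  have "\<exists>x\<in>carrier (artin_B n). word_dist (artin_A n) (P_A n) (eta n x) y \<le> m"
    if y: "y \<in> carrier (artin_A n)" for y
  proof -
    \<comment> \<open>The representatives stand to the left of the image of \<open>eta\<close>,
      whereas the distance needs \<open>y\<close> as an image times a bounded element; inverting
      \<open>y\<close> reverses the order.\<close>
    obtain l h where l: "l \<le> n" "h \<in> carrier (artin_B n)"
      "inv\<^bsub>artin_A n\<^esub> y = A.desc l \<cdot> eta n h"
      using desc_transversal[of "inv\<^bsub>artin_A n\<^esub> y" 0] y by auto
    have "y = inv\<^bsub>artin_A n\<^esub> (A.desc l \<cdot> eta n h)" using l(3) y by (metis A.inv_inv)
    then have "y = inv\<^bsub>artin_A n\<^esub> (eta n h) \<cdot> inv\<^bsub>artin_A n\<^esub> (A.desc l)"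
      using l by (simp add: A.inv_mult_group)
    then have "inv\<^bsub>artin_A n\<^esub> (eta n (inv\<^bsub>artin_B n\<^esub> h)) \<cdot> y = inv\<^bsub>artin_A n\<^esub> (A.desc l)"
      using l by (simp add: A.m_assoc[symmetric])
    then have "word_dist (artin_A n) (P_A n) (eta n (inv\<^bsub>artin_B n\<^esub> h)) y \<le> m"
      using m l(1) by (intro A.word_dist_le) auto
    then show ?thesis using l(2) by blast
  qed
  then show ?thesis by blast
qed

lemma quasi_isometry_eta:
  "quasi_isometry
    (carrier (artin_B n)) (\<lambda>g h. real (word_dist (artin_B n) (P_B n) g h))
    (carrier (artin_A n)) (\<lambda>g h. real (word_dist (artin_A n) (P_A n) g h))
    (eta n)"
proof -
  let ?dA = "word_dist (artin_A n) (P_A n)" and ?dB = "word_dist (artin_B n) (P_B n)"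
  obtain L where L: "\<And>x y. x \<in> carrier (artin_B n) \<Longrightarrow> y \<in> carrier (artin_B n) \<Longrightarrow>
      ?dB x y \<le> L * ?dA (eta n x) (eta n y)"
    using eta_dist_ge by blast
  \<comment> \<open>Taking \<open>L + 1\<close> makes the multiplicative constant at least 1 even
    when \<open>L = 0\<close>; the additive constant is 0.\<close>
  have "real (?dB x y) / real (L + 1) - 0 \<le> real (?dA (eta n x) (eta n y)) \<and>
      real (?dA (eta n x) (eta n y)) \<le> real (L + 1) * real (?dB x y) + 0"
    if "x \<in> carrier (artin_B n)" "y \<in> carrier (artin_B n)" for x y
  proof -
    have "?dB x y \<le> ?dA (eta n x) (eta n y) * (L + 1)" using L[OF that] by (simp add: algebra_simps)
    then have "real (?dB x y) \<le> real (?dA (eta n x) (eta n y)) * real (L + 1)"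
      by (metis of_nat_le_iff of_nat_mult)
    moreover have "?dA (eta n x) (eta n y) \<le> (L + 1) * ?dB x y"
      using eta_dist_le[OF that] by simp
    then have "real (?dA (eta n x) (eta n y)) \<le> real (L + 1) * real (?dB x y)"
      by (metis of_nat_le_iff of_nat_mult)
    ultimately show ?thesis by (simp add: pos_divide_le_eq)
  qed
  moreover have "eta n ` carrier (artin_B n) \<subseteq> carrier (artin_A n)" by auto
  moreover have "\<exists>D::real. \<forall>y\<in>carrier (artin_A n). \<exists>x\<in>carrier (artin_B n). real (?dA (eta n x) y) \<le> D"
    using eta_coarsely_surjective by (meson of_nat_le_iff)
  moreover have "(1::real) \<le> real (L + 1)" by simp
  ultimately show ?thesis unfolding quasi_isometry_def by (metis order_refl)
qed

end

theorem proposition2: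
  fixes n :: nat
  assumes "n \<ge> 3"
  shows "eta n \<in> mon (artin_B n) (artin_A n) \<and>
    quasi_isometry
      (carrier (artin_B n)) (\<lambda>g h. real (word_dist (artin_B n) (P_B n) g h))
      (carrier (artin_A n)) (\<lambda>g h. real (word_dist (artin_A n) (P_A n) g h))
      (eta n)"
proof -
  interpret artin_embedding n by unfold_locales (rule assms)
  show ?thesis using eta_mon quasi_isometry_eta by blast
qed

end
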